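(* Let $$A(v)=\int_0^\infty\left(\frac{1}{xv}-\frac{1}{e^{xv}-1}\right)\left(\frac1x-\frac{1}{e^x-1}\right)dx,\qquad v>0.$$ Then $A$ is infinitely differentiable on $(0,\infty)$ and for every integer $k\ge0$, $$A^{(k)}(1)=(-1)^kk!\left((1+\delta_{k,0})C-\frac{1}{2(k+1)}-\frac{H_{k-1}}{2}+\sum_{j=2}^{k}\binom{k}{j-1}\frac{\zeta(j)B_j}{j}\right).$$
   Context: $C=\frac{\log(2\pi)-\gamma}{2}$ where $\gamma$ is the Euler–Mascheroni constant. $H_k=\sum_{j=1}^k\frac1j$ for $k\ge1$, with $H_{-1}=H_0=0$. $\delta_{k,0}$ is the Kronecker delta. The Bernoulli numbers $B_n$ are defined by $\frac{t}{e^t-1}=\sum_{n\ge0}B_n\frac{t^n}{n!}$. $\zeta$ is the Riemann zeta function. Empty sums are $0$. *)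

theory Defs
  imports "HOL-Analysis.Analysis" "HOL-Computational_Algebra.Formal_Power_Series"
begin

definition bernoulli_num :: "nat \<Rightarrow> real" where
  "bernoulli_num n = fact n * fps_nth (fps_X div (fps_exp 1 - 1)) n"

text \<open>Riemann zeta at real s (used only for integers s >= 2, where the series converges).\<close>
definition zeta_real :: "real \<Rightarrow> real" where
  "zeta_real s = (\<Sum>n. 1 / (real (Suc n)) powr s)"

definition C_const :: real where
  "C_const = (ln (2 * pi) - euler_mascheroni) / 2"

definition A_fun :: "real \<Rightarrow> real" where
  "A_fun v = (LBINT x:{0<..}. (1 / (x * v) - 1 / (exp (x * v) - 1)) * (1 / x - 1 / (exp x - 1)))"

end

theory Submission
  imports Defs "HOL-Complex_Analysis.Complex_Analysis" "HOL-Real_Asymp.Real_Asymp"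
begin

text \<open>
  Write \<open>\<phi>(x) = 1/x - 1/(e\<^sup>x - 1)\<close>, so that \<open>A(v)\<close> integrates \<open>\<phi>(xv) \<phi>(x)\<close>. Expanding \<open>\<phi>(xv)\<close>
  as a geometric sum, with a remainder that decays like \<open>e\<^sup>-\<^sup>N\<^sup>x\<^sup>v\<close>, and using that the Laplace
  transform of \<open>\<phi>\<close> at \<open>t\<close> is \<open>\<psi>(t + 1) - ln t\<close>, one obtains with Stirling's formula
  \<open>A(v) = (C + (ln v)/2)/v - (\<Sum>m\<ge>1. g(mv))\<close> for \<open>g(z) = \<psi>(z + 1) - ln z - 1/(2z)\<close>.
  Since \<open>g(z)\<close> is of order \<open>1/z\<^sup>2\<close>, the series converges locally uniformly on the half-plane
  \<open>Re z > 0\<close>, which gives smoothness and lets one differentiate termwise. At \<open>v = 1\<close> and for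
  \<open>k \<ge> 1\<close> the terms \<open>m\<^sup>k g\<^sup>(\<^sup>k\<^sup>)(m)\<close> contain the tails \<open>\<Sum>r>m. r\<^sup>-\<^sup>k\<^sup>-\<^sup>1\<close>. Exchanging the two summations
  produces the power sums \<open>\<Sum>m<r. m\<^sup>k\<close>, and the Bernoulli formula for these turns the
  double sum into the values \<open>\<zeta>(j)\<close>.
\<close>

subsection \<open>The remainder of the digamma function\<close>

text \<open>The first two terms of the expansion of psi(z + 1) at infinity are removed. What is left
  is of order 1/z^2, so its values at the multiples of z are summable.\<close>

definition psi_rem :: "complex \<Rightarrow> complex" where
  "psi_rem z = Digamma (z + 1) - ln z - 1 / (2 * z)"

text \<open>This is the error of the trapezoidal rule for the integral of 1/w over
  [z, z + 1].\<close>

lemma trapezoid_error_ln: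
  assumes "Re z > 0"
  shows "norm (ln (z + 1) - ln z - (1 / z + 1 / (z + 1)) / 2) \<le> 1 / (2 * Re z ^ 3)"
proof -
  \<comment> \<open>Up to the constant ln z, this is the trapezoidal error on [z, z + s]. All terms
    of its derivative below order s^2 cancel, and the mean value inequality on [0, 1]
    finishes.\<close>
  define u where "u s = ln (z + s) - s / 2 * (1 / z + 1 / (z + s))" for s
  define u' where "u' s = - (s ^ 2) / (2 * z * (z + s) ^ 2)" for s
  have *: "(u has_field_derivative u' s) (at s within closed_segment 0 1) \<and> norm (u' s) \<le> 1 / (2 * Re z ^ 3)"
    if "s \<in> closed_segment 0 1" for s
  proof -
    from that obtain t where t: "s = of_real t" "0 \<le> t" "t \<le> 1"
      by (auto simp: in_segment scaleR_conv_of_real)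
    have Re: "Re (z + s) > 0" using assms t by auto
    hence nz: "z + s \<noteq> 0" "z \<noteq> 0" using assms by (metis less_irrefl zero_complex.sel(1))+
    have nonpos: "z + s \<notin> \<real>\<^sub>\<le>\<^sub>0" using Re by (auto simp: complex_nonpos_Reals_iff)
    have eq: "1 / (z + s) - (1 / 2 * (1 / z + 1 / (z + s)) + s / 2 * (- 1 / (z + s) ^ 2)) = u' s"
      unfolding u'_def using nz by (simp add: divide_simps) algebra
    have "(u has_field_derivative u' s) (at s within closed_segment 0 1)"
      unfolding u_def eq [symmetric]
      by (rule derivative_eq_intros refl nonpos nz | simp add: nz nonpos power2_eq_square inverse_eq_divide mult_ac)+
    moreover have "Re z \<le> norm z" by (rule complex_Re_le_cmod)
    moreover have "Re z \<le> norm (z + s)"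
      using complex_Re_le_cmod[of "z + s"] t by auto
    ultimately show ?thesis
    proof (intro conjI)
      assume a: "Re z \<le> norm z" "Re z \<le> norm (z + s)"
      have "Re z ^ 3 = Re z * Re z ^ 2" by (simp add: power_numeral_reduce)
      also have "\<dots> \<le> norm z * norm (z + s) ^ 2"
        using a assms by (intro mult_mono power_mono) auto
      finally have "2 * Re z ^ 3 \<le> 2 * norm z * norm (z + s) ^ 2" by simp
      moreover have "t ^ 2 \<le> 1" using t by (simp add: power_le_one)
      ultimately have "t ^ 2 / (2 * norm z * norm (z + s) ^ 2) \<le> 1 / (2 * Re z ^ 3)"
        using assms by (intro frac_le) auto
      thus "norm (u' s) \<le> 1 / (2 * Re z ^ 3)"
        unfolding u'_def t(1) by (simp add: norm_divide norm_mult norm_power)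
    qed
  qed
  have "norm (u 1 - u 0) \<le> 1 / (2 * Re z ^ 3) * norm (1 - 0 :: complex)"
    by (rule field_differentiable_bound[where S = "closed_segment 0 1" and f' = u'])
       (use * in auto)
  moreover have "u 1 - u 0 = ln (z + 1) - ln z - (1 / z + 1 / (z + 1)) / 2"
    by (simp add: u_def)
  ultimately show ?thesis by simp
qed

text \<open>Integral comparison: the first term is kept, and the others are bounded by the integral
  of 1/x^3 from a to infinity.\<close>

lemma sum_inverse_cubes_le:
  fixes a :: real
  assumes "a > 0"
  shows "(\<Sum>n<N. 1 / (a + real n) ^ 3) \<le> 1 / a ^ 3 + 1 / (2 * a ^ 2)"
proof -
  \<comment> \<open>Subtracting the integral from a + N onwards makes the bound strong enough for
    induction.\<close>
  have "(\<Sum>n<Suc N. 1 / (a + real n) ^ 3) \<le> 1 / a ^ 3 + 1 / (2 * a ^ 2) - 1 / (2 * (a + real N) ^ 2)" for N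
  proof (induction N)
    case (Suc N)
    define b where "b = a + real N"
    have b: "b > 0" using assms by (simp add: b_def)
    have "1 / b ^ 2 - 1 / (b + 1) ^ 2 - 2 / (b + 1) ^ 3 = (3 * b + 1) / (b ^ 2 * (b + 1) ^ 3)"
      using b by (simp add: divide_simps) algebra
    also have "\<dots> \<ge> 0" using b by simp
    finally have "1 / (b + 1) ^ 3 \<le> 1 / (2 * b ^ 2) - 1 / (2 * (b + 1) ^ 2)" by simp
    with Suc show ?case by (simp add: b_def add_ac)
  qed (use assms in auto)
  from this[of N] have "(\<Sum>n<Suc N. 1 / (a + real n) ^ 3) \<le> 1 / a ^ 3 + 1 / (2 * a ^ 2)"
    by (rule order_trans) auto
  moreover have "1 / (a + real N) ^ 3 \<ge> 0" using assms by (intro divide_nonneg_nonneg) auto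
  ultimately show ?thesis unfolding sum.lessThan_Suc by linarith
qed

text \<open>The recurrence turns the limit formula for psi(z + 1) into psi(z + 1 + N) - ln N -> 0,
  and ln (z + N) - ln N = ln (1 + z/N) -> 0.\<close>

lemma Digamma_plus_of_nat_minus_ln:
  assumes "Re z > 0"
  shows "(\<lambda>N. Digamma (z + 1 + of_nat N) - ln (z + of_nat N)) \<longlonglongrightarrow> 0"
proof -
  have nz: "z + 1 \<noteq> 0" using assms by (auto simp: complex_eq_iff)
  have D: "Digamma (z + 1 + of_nat N) = Digamma (z + 1) + (\<Sum>n<N. inverse (z + 1 + of_nat n))" for N
  proof (induction N)
    case (Suc N)
    have "z + 1 + of_nat N \<noteq> 0" using assms by (auto simp: complex_eq_iff)
    from Digamma_plus1[OF this] Suc show ?case by (simp add: add_ac inverse_eq_divide)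
  qed auto
  have "(\<lambda>N. Digamma (z + 1) - (of_real (ln (real N)) - (\<Sum>n<N. inverse (z + 1 + of_nat n)))) 
      \<longlonglongrightarrow> Digamma (z + 1) - Digamma (z + 1)"
    by (intro tendsto_intros Digamma_LIMSEQ nz)
  hence 1: "(\<lambda>N. Digamma (z + 1 + of_nat N) - of_real (ln (real N))) \<longlonglongrightarrow> 0"
    unfolding D by (simp add: algebra_simps)
  have "(\<lambda>N. inverse (of_nat N :: complex)) \<longlonglongrightarrow> 0"
    by (rule lim_inverse_n)
  hence "(\<lambda>N. ln (1 + z * inverse (of_nat N))) \<longlonglongrightarrow> ln (1 + z * 0)"
    by (intro tendsto_intros) auto
  moreover have "eventually (\<lambda>N. ln (1 + z * inverse (of_nat N)) = ln (z + of_nat N) - of_real (ln (real N))) sequentially"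
    using eventually_gt_at_top[of 0]
  proof eventually_elim
    case (elim N)
    have "z + of_nat N \<noteq> 0" using assms by (auto simp: complex_eq_iff)
    moreover have "1 + z * inverse (of_nat N) = (z + of_nat N) / of_real (real N)"
      using elim by (simp add: field_simps)
    ultimately show ?case using elim Ln_divide_of_real[of "real N" "z + of_nat N"] by simp
  qed
  ultimately have "(\<lambda>N. ln (z + of_nat N) - of_real (ln (real N))) \<longlonglongrightarrow> 0"
    by (simp add: filterlim_cong)
  from tendsto_diff[OF 1 this] show ?thesis by simp
qed

text \<open>\<open>psi_rem w - psi_rem (w + 1)\<close> is exactly the trapezoidal error at w, and
  \<open>psi_rem (z + N)\<close> tends to 0. Hence \<open>psi_rem z\<close> is the sum of the errors
  at z, z + 1, z + 2 and so on, which the cubes bound.\<close>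

lemma norm_psi_rem_le:
  assumes "Re z > 0"
  shows "norm (psi_rem z) \<le> (1 / Re z ^ 3 + 1 / (2 * Re z ^ 2)) / 2"
proof -
  define h where "h z = ln (z + 1) - ln z - (1 / z + 1 / (z + 1)) / 2" for z :: complex
  have step: "psi_rem w - psi_rem (w + 1) = h w" if "Re w > 0" for w
  proof -
    have "w + 1 \<noteq> 0" using that by (auto simp: complex_eq_iff)
    from Digamma_plus1[OF this]
    have "psi_rem (w + 1) = Digamma (w + 1) + 1 / (w + 1) - ln (w + 1) - 1 / (w + 1) / 2"
      unfolding psi_rem_def divide_divide_eq_left by (simp only: mult.commute)
    moreover have "psi_rem w = Digamma (w + 1) - ln w - 1 / w / 2"
      unfolding psi_rem_def divide_divide_eq_left by (simp only: mult.commute)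
    moreover have "(D - M - p / 2) - (D + q - L - q / 2) = L - M - (p + q) / 2" for D L M p q :: complex
      by (simp add: field_simps)
    ultimately show ?thesis
      unfolding h_def by (simp only:)
  qed
  have tele: "psi_rem z - psi_rem (z + of_nat N) = (\<Sum>n<N. h (z + of_nat n))" for N
  proof (induction N)
    case (Suc N)
    have "Re (z + of_nat N) > 0" using assms by simp
    from step[OF this] Suc show ?case by (simp add: add_ac algebra_simps)
  qed auto
  have "(\<lambda>N. 1 / (2 * (z + of_nat N))) \<longlonglongrightarrow> 0"
  proof -
    have "(\<lambda>N. (1/2) * inverse (z + of_nat N)) \<longlonglongrightarrow> (1/2) * 0"
      by (intro tendsto_intros filterlim_compose[OF tendsto_inverse_0]
              tendsto_add_filterlim_at_infinity[OF tendsto_const] tendsto_of_nat)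
    thus ?thesis by (simp add: inverse_eq_divide)
  qed
  from tendsto_diff[OF Digamma_plus_of_nat_minus_ln[OF assms] this]
  have "(\<lambda>N. psi_rem (z + of_nat N)) \<longlonglongrightarrow> 0"
    by (simp add: psi_rem_def add_ac)
  from tendsto_norm[OF tendsto_diff[OF tendsto_const this]]
  have lim: "(\<lambda>N. norm (psi_rem z - psi_rem (z + of_nat N))) \<longlonglongrightarrow> norm (psi_rem z)"
    by simp
  have "norm (psi_rem z - psi_rem (z + of_nat N)) \<le> (1 / Re z ^ 3 + 1 / (2 * Re z ^ 2)) / 2" for N
  proof -
    have "norm (psi_rem z - psi_rem (z + of_nat N)) \<le> (\<Sum>n<N. norm (h (z + of_nat n)))"
      unfolding tele by (rule norm_sum)
    also have "\<dots> \<le> (\<Sum>n<N. 1 / (2 * Re (z + of_nat n) ^ 3))"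
      unfolding h_def using assms by (intro sum_mono trapezoid_error_ln) simp
    also have "\<dots> = (\<Sum>n<N. 1 / (Re z + real n) ^ 3) / 2"
      by (simp add: sum_divide_distrib mult.commute)
    finally show ?thesis using sum_inverse_cubes_le[OF assms, of N] by simp
  qed
  thus ?thesis by (intro LIMSEQ_le_const2[OF lim]) auto
qed

subsection \<open>Power sums and Bernoulli numbers\<close>

text \<open>The \<open>div\<close> in \<open>bernoulli_num\<close> is an exact quotient:
  \<open>fps_exp 1 - 1\<close> has subdegree 1 and therefore divides \<open>fps_X\<close>.\<close>

lemma bernoulli_fps:
  defines "b \<equiv> (fps_X div (fps_exp 1 - 1) :: real fps)"
  shows "b * (fps_exp 1 - 1) = fps_X"
proof -
  have nz: "fps_exp 1 - 1 \<noteq> (0 :: real fps)"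
  proof
    assume "fps_exp 1 - 1 = (0 :: real fps)"
    hence "fps_nth (fps_exp 1 - 1 :: real fps) 1 = 0" by simp
    thus False by simp
  qed
  have "subdegree (fps_exp 1 - 1 :: real fps) = 1"
    by (rule subdegreeI) auto
  hence "(fps_exp 1 - 1 :: real fps) dvd fps_X" using nz by (simp add: fps_dvd_iff)
  thus ?thesis unfolding b_def by simp
qed

text \<open>Compare the coefficients of X^(k+1) in X * (sum of e^(mX) over m < r) = X/(e^X - 1) *
  (e^(rX) - 1).\<close>

lemma sum_powers_bernoulli:
  "(\<Sum>m<r. real m ^ k) = (\<Sum>l\<le>k. real (Suc k choose l) * bernoulli_num l * real r ^ (Suc k - l)) / real (Suc k)"
proof -
  define b where "b = (fps_X div (fps_exp 1 - 1) :: real fps)"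
  define S where "S = (\<Sum>m<r. fps_exp (real m))"
  have "(fps_exp 1 - 1) * S = fps_exp (real r) - 1"
    unfolding S_def
  proof (induction r)
    case (Suc r)
    have "(fps_exp 1 - 1) * (\<Sum>m<Suc r. fps_exp (real m)) =
        (fps_exp 1 - 1) * (\<Sum>m<r. fps_exp (real m)) + (fps_exp 1 - 1) * fps_exp (real r)"
      by (simp add: distrib_left)
    also have "\<dots> = fps_exp (real (Suc r)) - 1"
      unfolding Suc by (simp add: ring_distribs fps_exp_add_mult add.commute)
    finally show ?case .
  qed auto
  hence "b * (fps_exp 1 - 1) * S = b * (fps_exp (real r) - 1)" by (simp add: mult.assoc)
  hence "fps_X * S = b * (fps_exp (real r) - 1)" 
    unfolding b_def bernoulli_fps .
  hence "fps_nth (fps_X * S) (Suc k) = fps_nth (b * (fps_exp (real r) - 1)) (Suc k)" by simp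
  hence "(\<Sum>m<r. real m ^ k / fact k) = (\<Sum>l\<le>Suc k. fps_nth b l * fps_nth (fps_exp (real r) - 1) (Suc k - l))"
    unfolding fps_mult_nth[of b] fps_X_mult_nth by (simp add: S_def fps_sum_nth atLeast0AtMost del: sum.atMost_Suc)
  \<comment> \<open>The term l = k + 1 drops out because e^(rX) - 1 has constant coefficient
    0.\<close>
  also have "\<dots> = (\<Sum>l\<le>k. fps_nth b l * (real r ^ (Suc k - l) / fact (Suc k - l)))"
    unfolding sum.atMost_Suc by (auto simp del: fact_Suc intro!: sum.cong)
  also have "\<dots> = (\<Sum>l\<le>k. real (Suc k choose l) * bernoulli_num l * real r ^ (Suc k - l)) / fact (Suc k)"
    unfolding sum_divide_distrib
  proof (intro sum.cong refl)
    fix l assume "l \<in> {..k}"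
    hence "real (Suc k choose l) = fact (Suc k) / (fact l * fact (Suc k - l))"
      by (subst binomial_fact) auto
    thus "fps_nth b l * (real r ^ (Suc k - l) / fact (Suc k - l)) =
       real (Suc k choose l) * bernoulli_num l * real r ^ (Suc k - l) / fact (Suc k)"
      by (simp add: bernoulli_num_def b_def del: fact_Suc)
  qed
  finally have "(\<Sum>m<r. real m ^ k) / fact k =
      (\<Sum>l\<le>k. real (Suc k choose l) * bernoulli_num l * real r ^ (Suc k - l)) / fact (Suc k)"
    (is "?A / _ = ?B / _") by (simp add: sum_divide_distrib)
  hence "?A = ?B / fact (Suc k) * fact k" by (simp add: divide_simps)
  thus "?A = ?B / real (Suc k)" unfolding fact_Suc by simp
qed

text \<open>For r = 1 the power sum is 0^k, so the formula becomes the usual recurrence for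
  Bernoulli numbers.\<close>

lemma bernoulli_num_0 [simp]: "bernoulli_num 0 = 1"
  using sum_powers_bernoulli[where r=1 and k=0] by simp

lemma bernoulli_num_1 [simp]: "bernoulli_num (Suc 0) = - 1 / 2"
  using sum_powers_bernoulli[where r=1 and k=1] by (simp add: lessThan_Suc)

subsection \<open>Laplace transforms\<close>

definition phi :: "real \<Rightarrow> real" where
  "phi x = 1 / x - 1 / (exp x - 1)"

lemma borel_measurable_phi [measurable]: "phi \<in> borel_measurable borel"
  unfolding phi_def by measurable

text \<open>Both bounds come from e^y >= 1 + y, taken at y = x and at y = -x. Nonnegativity later
  permits Tonelli, and boundedness controls the remainders.\<close>

lemma phi_bounds:
  assumes "x > 0"
  shows "phi x \<ge> 0" "phi x \<le> 1"
proof -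
  have e: "exp x \<ge> 1 + x" by (rule exp_ge_add_one_self)
  have "exp (-x) \<ge> 1 - x" using exp_ge_add_one_self[of "-x"] by simp
  hence "exp (-x) * exp x \<ge> (1 - x) * exp x" by (intro mult_right_mono) auto
  hence "exp x - 1 \<le> x * exp x" by (simp add: exp_minus algebra_simps)
  thus "phi x \<ge> 0" "phi x \<le> 1" using e assms
    by (auto simp: phi_def divide_simps algebra_simps)
qed

text \<open>This is N steps of the geometric series for 1/(e^x - 1). Splitting 1/x in the same way
  leaves the remainder e^(-Nx) phi(x), which stays bounded near 0, whereas e^(-Nx)/(e^x - 1) does
  not.\<close>

lemma phi_expand:
  assumes "x > 0"
  shows "phi x = (1 - exp (-(real N * x))) / x - (\<Sum>m<N. exp (-(real (Suc m) * x))) + exp (-(real N * x)) * phi x"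
proof (induction N)
  case (Suc N)
  define q where "q = exp (-(real N * x))"
  have ex: "exp x \<noteq> 1" using assms by simp
  have eq: "exp (-(real (Suc N) * x)) = q / exp x"
    by (simp add: q_def exp_minus exp_diff field_simps exp_add)
  have "q / (exp x - 1) = q / exp x + q / exp x / (exp x - 1)"
    using ex by (simp add: divide_simps) (simp add: algebra_simps)
  hence "q * phi x = (q - q / exp x) / x - q / exp x + (q / exp x) * phi x"
    unfolding phi_def by (simp add: right_diff_distrib diff_divide_distrib)
  thus ?case using Suc assms unfolding sum.lessThan_Suc eq
    unfolding q_def [symmetric] by (simp add: diff_divide_distrib)
qed simp

section \<open>Laplace integrals by Tonelli's theorem\<close>

lemma has_bochner_integral_nonnegD:
  fixes f :: "'a \<Rightarrow> real"
  assumes "has_bochner_integral M f I" "\<And>x. f x \<ge> 0"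
  shows "I \<ge> 0"
  using assms Bochner_Integration.integral_nonneg[of M f] by (simp add: has_bochner_integral_iff)

lemma nn_integral_has_bochner_integral:
  fixes f :: "'a \<Rightarrow> real"
  assumes "has_bochner_integral M f I" "\<And>x. f x \<ge> 0"
  shows "(\<integral>\<^sup>+ x. ennreal (f x) \<partial>M) = ennreal I"
  using assms nn_integral_eq_integral[of M f] by (simp add: has_bochner_integral_iff)

lemma has_bochner_integral_cong_AE_singleton:
  fixes f g :: "real \<Rightarrow> real"
  assumes "has_bochner_integral lborel f I" "g \<in> borel_measurable lborel"
    and "\<And>x. x \<notin> {a, b} \<Longrightarrow> f x = g x"
  shows "has_bochner_integral lborel g I"
proof -
  have "AE x in lborel. x \<noteq> a" "AE x in lborel. x \<noteq> b" by (rule AE_lborel_singleton)+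
  hence "AE x in lborel. f x = g x" by eventually_elim (use assms(3) in auto)
  with assms(1,2) show ?thesis
    using has_bochner_integral_cong_AE[of f lborel g I] borel_measurable_has_bochner_integral by blast
qed

text \<open>Since (e^(-ax) - e^(-bx))/x is the integral of e^(-sx) over s in [a, b], Tonelli's
  theorem reduces the claim to integrating the Laplace transform H of f. Only H on the open interval
  is used: a = 0 must be allowed, and the transform of \<open>phi\<close> diverges there.\<close>

lemma has_bochner_integral_laplace_diff:
  fixes f H :: "real \<Rightarrow> real"
  assumes [measurable]: "f \<in> borel_measurable borel"
    and f: "\<And>x. x > 0 \<Longrightarrow> f x \<ge> 0"
    and ab: "0 \<le> a" "a < b"
    and H: "\<And>s. a < s \<Longrightarrow> s < b \<Longrightarrow>
              has_bochner_integral lborel (\<lambda>x. indicator {0<..} x * (f x * exp (-(s * x)))) (H s)"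
    and I: "has_bochner_integral lborel (\<lambda>s. indicator {a<..<b} s * H s) I"
  shows "has_bochner_integral lborel
           (\<lambda>x. indicator {0<..} x * (f x * (exp (-(a * x)) - exp (-(b * x))) / x)) I"
proof (rule has_bochner_integral_nn_integral)
  define h where "h x s = indicator {0<..} x * f x * (indicator {a<..<b} s * exp (-(s * x)))" for x s
  have h [measurable]: "(\<lambda>(x, s). h x s) \<in> borel_measurable (lborel \<Otimes>\<^sub>M lborel)"
    unfolding h_def by measurable
  have h_nonneg: "h x s \<ge> 0" for x s
    unfolding h_def using f by (auto simp: indicator_def)
  have H_nonneg: "H s \<ge> 0" if "a < s" "s < b" for s
    by (rule has_bochner_integral_nonnegD[OF H[OF that]]) (use f in \<open>auto simp: indicator_def\<close>)
  show "(\<lambda>x. indicator {0<..} x * (f x * (exp (-(a * x)) - exp (-(b * x))) / x)) \<in> borel_measurable lborel"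
    by measurable
  show "AE x in lborel. 0 \<le> indicator {0<..} x * (f x * (exp (-(a * x)) - exp (-(b * x))) / x)"
  proof (rule AE_I2)
    fix x :: real
    show "0 \<le> indicator {0<..} x * (f x * (exp (-(a * x)) - exp (-(b * x))) / x)"
    proof (cases "x > 0")
      case True
      hence "exp (-(b * x)) \<le> exp (-(a * x))" using ab by simp
      with True f[OF True] show ?thesis by simp
    qed simp
  qed
  show "0 \<le> I"
    by (rule has_bochner_integral_nonnegD[OF I]) (use H_nonneg in \<open>auto simp: indicator_def\<close>)
  have 1: "ennreal (indicator {0<..} x * (f x * (exp (-(a * x)) - exp (-(b * x))) / x)) = (\<integral>\<^sup>+ s. ennreal (h x s) \<partial>lborel)"
    for x
  proof (cases "x > 0")
    case True
    have "(\<integral>\<^sup>+ s. ennreal (h x s) \<partial>lborel) = (\<integral>\<^sup>+ s. ennreal (f x * exp (-(s * x))) * indicator {a..b} s \<partial>lborel)"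
    proof (rule nn_integral_cong_AE)
      have "AE s in lborel. s \<noteq> a" "AE s in lborel. s \<noteq> b" by (rule AE_lborel_singleton)+
      thus "AE s in lborel. ennreal (h x s) = ennreal (f x * exp (-(s * x))) * indicator {a..b} s"
        by eventually_elim (use True in \<open>auto simp: h_def indicator_def\<close>)
    qed
    also have "\<dots> = ennreal ((- f x * exp (-(b * x)) / x) - (- f x * exp (-(a * x)) / x))"
    proof (rule nn_integral_FTC_Icc)
      show "((\<lambda>s. - f x * exp (-(s * x)) / x) has_real_derivative f x * exp (-(s * x))) (at s)" for s
        using True by (auto intro!: derivative_eq_intros)
    qed (use ab f[OF True] in auto)
    also have "(- f x * exp (-(b * x)) / x) - (- f x * exp (-(a * x)) / x) = f x * (exp (-(a * x)) - exp (-(b * x))) / x"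
      by (simp add: diff_divide_distrib algebra_simps)
    finally show ?thesis using True by simp
  qed (simp add: h_def)
  have 2: "(\<integral>\<^sup>+ x. ennreal (h x s) \<partial>lborel) = ennreal (indicator {a<..<b} s * H s)" for s
  proof (cases "s \<in> {a<..<b}")
    case True
    have "(\<integral>\<^sup>+ x. ennreal (h x s) \<partial>lborel) = (\<integral>\<^sup>+ x. ennreal (indicator {0<..} x * (f x * exp (-(s * x)))) \<partial>lborel)"
      using True by (simp add: h_def mult_ac)
    also have "\<dots> = ennreal (H s)"
      by (rule nn_integral_has_bochner_integral[OF H])
         (use True f in \<open>auto simp: indicator_def\<close>)
    finally show ?thesis using True by simp
  qed (simp add: h_def)
  have "(\<integral>\<^sup>+ x. ennreal (indicator {0<..} x * (f x * (exp (-(a * x)) - exp (-(b * x))) / x)) \<partial>lborel)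
      = (\<integral>\<^sup>+ x. \<integral>\<^sup>+ s. ennreal (h x s) \<partial>lborel \<partial>lborel)"
    by (simp only: 1)
  also have "\<dots> = (\<integral>\<^sup>+ s. \<integral>\<^sup>+ x. ennreal (h x s) \<partial>lborel \<partial>lborel)"
    by (rule lborel_pair.Fubini' [symmetric]) measurable
  also have "\<dots> = (\<integral>\<^sup>+ s. ennreal (indicator {a<..<b} s * H s) \<partial>lborel)"
    by (simp only: 2)
  also have "\<dots> = ennreal I"
    by (rule nn_integral_has_bochner_integral[OF I])
       (use H_nonneg in \<open>auto simp: indicator_def\<close>)
  finally show "(\<integral>\<^sup>+ x. ennreal (indicator {0<..} x * (f x * (exp (-(a * x)) - exp (-(b * x))) / x)) \<partial>lborel) = ennreal I" .
qed

lemma has_bochner_integral_exp_neg: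
  fixes s :: real
  assumes "s > 0"
  shows "has_bochner_integral lborel (\<lambda>x. indicator {0<..} x * exp (-(s * x))) (1 / s)"
proof -
  have "(\<integral>\<^sup>+x. ennreal (exp (-(s * x))) * indicator {0 ..} x \<partial>lborel) = ennreal (0 - (- exp (-(s * 0)) / s))"
  proof (rule nn_integral_FTC_atLeast)
    show "((\<lambda>x. - exp (-(s * x)) / s) has_real_derivative exp (-(s * x))) (at x)" for x
      using assms by (auto intro!: derivative_eq_intros)
    show "((\<lambda>x. - exp (-(s * x)) / s) \<longlongrightarrow> 0) at_top"
      using assms by real_asymp
  qed auto
  hence "(\<integral>\<^sup>+x. ennreal (indicator {0..} x * exp (-(s * x))) \<partial>lborel) = ennreal (1 / s)"
    by (simp add: ennreal_mult' ennreal_indicator mult.commute)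
  hence "has_bochner_integral lborel (\<lambda>x. indicator {0..} x * exp (-(s * x))) (1 / s)"
    using assms by (intro has_bochner_integral_nn_integral) auto
  thus ?thesis by (rule has_bochner_integral_cong_AE_singleton[of _ _ _ 0 0]) (auto simp: indicator_def)
qed

text \<open>The case f = 1, with Laplace transform 1/s.\<close>

lemma frullani_exp:
  fixes a b :: real
  assumes "0 < a" "a < b"
  shows "has_bochner_integral lborel (\<lambda>x. indicator {0<..} x * ((exp (-(a * x)) - exp (-(b * x))) / x)) (ln b - ln a)"
proof -
  have "has_bochner_integral lborel (\<lambda>s. 1 / s * indicator {a..b} s) (ln b - ln a)"
    by (rule has_bochner_integral_FTC_Icc_nonneg) (use assms in \<open>auto intro!: derivative_eq_intros continuous_intros\<close>)
  hence "has_bochner_integral lborel (\<lambda>s. indicator {a<..<b} s * (1 / s)) (ln b - ln a)"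
    by (rule has_bochner_integral_cong_AE_singleton[of _ _ _ a b]) (auto simp: indicator_def)
  from has_bochner_integral_laplace_diff[where f = "\<lambda>_. 1", OF _ _ _ _ _ this] show ?thesis
    using assms has_bochner_integral_exp_neg by simp
qed

text \<open>Domination by e^(-sx). The bound 1/s makes the remainders of the geometric expansions
  vanish in the limit.\<close>

lemma bounded_laplace_integral:
  fixes f :: "real \<Rightarrow> real"
  assumes [measurable]: "f \<in> borel_measurable borel"
    and f: "\<And>x. x > 0 \<Longrightarrow> f x \<ge> 0" "\<And>x. x > 0 \<Longrightarrow> f x \<le> 1" and "s > 0"
  shows "integrable lborel (\<lambda>x. indicator {0<..} x * (f x * exp (-(s * x))))"
    and "(LBINT x. indicator {0<..} x * (f x * exp (-(s * x)))) \<in> {0..1 / s}"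
proof -
  note E = has_bochner_integral_exp_neg[OF \<open>s > 0\<close>]
  have le: "f x * exp (-(s * x)) \<le> exp (-(s * x))" if "x > 0" for x
    using f[OF that] by (intro mult_left_le_one_le) auto
  show int: "integrable lborel (\<lambda>x. indicator {0<..} x * (f x * exp (-(s * x))))"
    by (rule Bochner_Integration.integrable_bound[OF has_bochner_integral_iff[THEN iffD1, OF E, THEN conjunct1]])
       (use f le in \<open>auto intro!: AE_I2 simp: indicator_def\<close>)
  have "(LBINT x. indicator {0<..} x * (f x * exp (-(s * x)))) \<le> (LBINT x. indicator {0<..} x * exp (-(s * x)))"
    using int E le by (intro integral_mono) (auto simp: has_bochner_integral_iff indicator_def)
  moreover have "(LBINT x. indicator {0<..} x * (f x * exp (-(s * x)))) \<ge> 0"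
    using f by (intro Bochner_Integration.integral_nonneg) (auto simp: indicator_def)
  ultimately show "(LBINT x. indicator {0<..} x * (f x * exp (-(s * x)))) \<in> {0..1 / s}"
    using E by (simp add: has_bochner_integral_iff)
qed

text \<open>Integrating \<open>phi_expand\<close> against e^(-tx) gives a Frullani integral,
  finitely many terms 1/(t + m) and a remainder of size at most 1/(t + N). As N grows, this becomes
  the limit formula for psi(t + 1).\<close>

lemma phi_laplace:
  assumes "t > 0"
  shows "has_bochner_integral lborel (\<lambda>x. indicator {0<..} x * (phi x * exp (-(t * x)))) (Digamma (t + 1) - ln t)"
proof -
  define G where "G = (LBINT x. indicator {0<..} x * (phi x * exp (-(t * x))))"
  have G: "has_bochner_integral lborel (\<lambda>x. indicator {0<..} x * (phi x * exp (-(t * x)))) G"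
    unfolding G_def using bounded_laplace_integral[OF _ phi_bounds assms]
    by (simp add: has_bochner_integral_iff)
  define R where "R N = (LBINT x. indicator {0<..} x * (phi x * exp (-((t + real N) * x))))" for N
  have pos: "t + real N > 0" for N using assms by simp
  have R: "has_bochner_integral lborel (\<lambda>x. indicator {0<..} x * (phi x * exp (-((t + real N) * x)))) (R N)"
    "R N \<in> {0..1 / (t + real N)}" for N
    unfolding R_def using bounded_laplace_integral[OF _ phi_bounds pos[of N]]
    by (simp_all add: has_bochner_integral_iff)
  have eq: "G = ln (t + real N) - ln t - (\<Sum>m<N. 1 / (t + real (Suc m))) + R N" if "N > 0" for N
  proof -
    have "has_bochner_integral lborel (\<lambda>x. 
        indicator {0<..} x * ((exp (-(t * x)) - exp (-((t + real N) * x))) / x)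
        - (\<Sum>m<N. indicator {0<..} x * exp (-((t + real (Suc m)) * x)))
        + indicator {0<..} x * (phi x * exp (-((t + real N) * x))))
        (ln (t + real N) - ln t - (\<Sum>m<N. 1 / (t + real (Suc m))) + R N)"
      using assms that
      by (intro has_bochner_integral_add has_bochner_integral_diff has_bochner_integral_sum
          frullani_exp R has_bochner_integral_exp_neg) auto
    also have "(\<lambda>x. indicator {0<..} x * ((exp (-(t * x)) - exp (-((t + real N) * x))) / x)
        - (\<Sum>m<N. indicator {0<..} x * exp (-((t + real (Suc m)) * x)))
        + indicator {0<..} x * (phi x * exp (-((t + real N) * x)))) =
        (\<lambda>x. indicator {0<..} x * (phi x * exp (-(t * x))))" (is "?l = ?r")
    proof
      fix x :: real
      show "?l x = ?r x"
      proof (cases "x > 0")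
        case True
        have shift: "exp (-((t + a) * x)) = exp (-(t * x)) * exp (-(a * x))" for a
          by (simp add: ring_distribs mult_exp_exp)
        have "phi x * exp (-(t * x)) = ((1 - exp (-(real N * x))) / x - (\<Sum>m<N. exp (-(real (Suc m) * x)))
            + exp (-(real N * x)) * phi x) * exp (-(t * x))"
          using phi_expand[OF True, of N] by simp
        also have "\<dots> = (exp (-(t * x)) - exp (-((t + real N) * x))) / x
           - (\<Sum>m<N. exp (-((t + real (Suc m)) * x))) + phi x * exp (-((t + real N) * x))"
          unfolding shift
          by (simp add: ring_distribs sum_distrib_left sum_distrib_right diff_divide_distrib mult_ac del: of_nat_Suc)
        finally show ?thesis using True by simp
      qed simp
    qed
    finally show ?thesis using G by (simp add: has_bochner_integral_iff)
  qed
  have "(\<lambda>N. 1 / (t + real N)) \<longlonglongrightarrow> 0" by real_asymp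
  hence R0: "R \<longlonglongrightarrow> 0"
    by (rule tendsto_sandwich[OF _ _ tendsto_const, rotated 2]) (use R(2) in auto)
  have L: "(\<lambda>N. ln (t + real N) - ln (real N)) \<longlonglongrightarrow> 0"
    by real_asymp
  have D: "(\<lambda>N. ln (real N) - (\<Sum>m<N. inverse (t + 1 + real m))) \<longlonglongrightarrow> Digamma (t + 1)"
    using Digamma_LIMSEQ[of "t + 1"] assms by simp
  have "(\<lambda>N. (ln (real N) - (\<Sum>m<N. inverse (t + 1 + real m))) + (ln (t + real N) - ln (real N)) - ln t + R N)
     \<longlonglongrightarrow> Digamma (t + 1) + 0 - ln t + 0"
    by (intro tendsto_intros R0 L D)
  moreover have "eventually (\<lambda>N. (ln (real N) - (\<Sum>m<N. inverse (t + 1 + real m))) + (ln (t + real N) - ln (real N)) - ln t + R N = G) sequentially"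
    using eventually_gt_at_top[of 0]
    by eventually_elim (simp add: eq inverse_eq_divide add_ac)
  ultimately have "(\<lambda>N. G) \<longlonglongrightarrow> Digamma (t + 1) - ln t"
    by (simp add: filterlim_cong)
  hence "G = Digamma (t + 1) - ln t"
    by (simp add: LIMSEQ_const_iff)
  with G show ?thesis by simp
qed

text \<open>The case a = 0, b = T for f = \<open>phi\<close>. It remains to integrate psi(s + 1) -
  ln s over (0, T), an improper integral because of the logarithm at 0.\<close>

lemma phi_laplace_diff:
  assumes "T > 0"
  shows "has_bochner_integral lborel (\<lambda>x. indicator {0<..} x * (phi x * (1 - exp (-(T * x))) / x))
           (ln_Gamma (T + 1) - T * ln T + T)"
proof -
  define F where "F s = ln_Gamma (s + 1) - s * ln s + s" for s :: real
  define H where "H s = Digamma (s + 1) - ln s" for s :: real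
  have nonneg: "H s \<ge> 0" if "s > 0" for s
    unfolding H_def using phi_laplace[OF that] phi_bounds
    by (intro has_bochner_integral_nonnegD[OF phi_laplace[OF that]]) (auto simp: indicator_def)
  have deriv: "(F has_real_derivative H s) (at s)" if "s > 0" for s
    unfolding F_def H_def using that by (auto intro!: derivative_eq_intros simp: field_simps)
  have cont: "isCont H s" if "s > 0" for s
    unfolding H_def using that
    by (intro continuous_intros) (auto elim!: nonpos_Ints_cases)
  \<comment> \<open>The antiderivative F tends to 0 at the lower end, since s ln s -> 0 and Gamma(1)
    = 1.\<close>
  have "((\<lambda>s. ln_Gamma (s + 1) - s * ln s + s) \<longlongrightarrow> ln_Gamma (0 + 1) - 0 + 0) (at_right (0::real))"
  proof (intro tendsto_intros)
    show "((\<lambda>s. s * ln s) \<longlongrightarrow> 0) (at_right (0::real))" by real_asymp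
    have "isCont (\<lambda>s. ln_Gamma (s + 1)) (0 :: real)"
      by (rule DERIV_isCont[where D = "Digamma (0 + 1)"]) (auto intro!: derivative_eq_intros)
    thus "((\<lambda>s. ln_Gamma (s + 1)) \<longlongrightarrow> ln_Gamma (0 + 1)) (at_right (0::real))"
      by (simp add: isCont_def filterlim_at_split)
  qed
  hence F0: "(F \<longlongrightarrow> 0) (at_right 0)"
    unfolding F_def by (simp add: ln_Gamma_real_conv_fact[of 1, simplified])
  have FT: "(F \<longlongrightarrow> F T) (at_left T)"
    using DERIV_isCont[OF deriv[OF assms]] by (simp add: isCont_def filterlim_at_split)
  have lims: "((F \<circ> real_of_ereal) \<longlongrightarrow> 0) (at_right (ereal 0))"
    "((F \<circ> real_of_ereal) \<longlongrightarrow> F T) (at_left (ereal T))"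
    using F0 FT by (simp_all only: ereal_tendsto_simps)
  note FTC = interval_integral_FTC_nonneg[where F = F and f = H and a = "ereal 0" and b = "ereal T", OF _ _ _ _ lims]
  have "set_integrable lborel (einterval (ereal 0) (ereal T)) H"
    by (rule FTC(1)) (use assms deriv cont nonneg in simp_all)
  moreover have "(LBINT x=ereal 0..ereal T. H x) = F T - 0"
    by (rule FTC(2)) (use assms deriv cont nonneg in simp_all)
  moreover have e: "einterval (ereal 0) (ereal T) = {0<..<T}"
    by (auto simp: einterval_def)
  ultimately have "has_bochner_integral lborel (\<lambda>s. indicator {0<..<T} s * H s) (F T)"
    unfolding has_bochner_integral_iff using assms
    by (simp add: e set_integrable_def interval_lebesgue_integral_def set_lebesgue_integral_def)
  from has_bochner_integral_laplace_diff[OF _ _ _ _ _ this, of phi]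
  show ?thesis
    using assms phi_bounds phi_laplace by (simp add: F_def H_def)
qed

text \<open>Only the factor phi(xv) is expanded. Its leading term is integrated by
  \<open>phi_laplace_diff\<close> with T = Nv, the exponentials by \<open>phi_laplace\<close>, and
  the remainder is at most 1/(Nv). The two parts diverge separately, each like (ln N)/(2v); only
  their difference converges.\<close>

lemma A_fun_LIMSEQ:
  assumes "v > 0"
  shows "(\<lambda>N. (ln_Gamma (real N * v + 1) - real N * v * ln (real N * v) + real N * v) / v
            - (\<Sum>m<N. Digamma (real (Suc m) * v + 1) - ln (real (Suc m) * v))) \<longlonglongrightarrow> A_fun v"
proof -
  define K where "K T = ln_Gamma (T + 1) - T * ln T + T" for T :: real
  define G where "G t = Digamma (t + 1) - ln t" for t :: real
  define f where "f x = phi x * phi (x * v)" for x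
  define R where "R N = (LBINT x. indicator {0<..} x * (f x * exp (-((real N * v) * x))))" for N
  have fm: "f \<in> borel_measurable borel" unfolding f_def by measurable
  have f: "f x \<ge> 0" "f x \<le> 1" if "x > 0" for x
    using phi_bounds[of x] phi_bounds[of "x * v"] that assms
    by (auto simp: f_def intro: mult_le_one)
  have R: "has_bochner_integral lborel (\<lambda>x. indicator {0<..} x * (f x * exp (-((real N * v) * x)))) (R N)"
    "R N \<in> {0..1 / (real N * v)}" if "N > 0" for N
    unfolding R_def using bounded_laplace_integral[OF fm f, of "real N * v"] that assms
    by (simp_all add: has_bochner_integral_iff)
  have A: "A_fun v = K (real N * v) / v - (\<Sum>m<N. G (real (Suc m) * v)) + R N" if "N > 0" for N
  proof -
    have "has_bochner_integral lborel (\<lambda>x.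
        indicator {0<..} x * (phi x * (1 - exp (-((real N * v) * x))) / x) / v
        - (\<Sum>m<N. indicator {0<..} x * (phi x * exp (-((real (Suc m) * v) * x))))
        + indicator {0<..} x * (f x * exp (-((real N * v) * x))))
        (K (real N * v) / v - (\<Sum>m<N. G (real (Suc m) * v)) + R N)"
      unfolding K_def G_def using assms that
      by (intro has_bochner_integral_add has_bochner_integral_diff has_bochner_integral_sum
          has_bochner_integral_divide_zero phi_laplace phi_laplace_diff R) auto
    also have "(\<lambda>x. indicator {0<..} x * (phi x * (1 - exp (-((real N * v) * x))) / x) / v
        - (\<Sum>m<N. indicator {0<..} x * (phi x * exp (-((real (Suc m) * v) * x))))
        + indicator {0<..} x * (f x * exp (-((real N * v) * x)))) =
        (\<lambda>x. indicator {0<..} x *\<^sub>R (phi (x * v) * phi x))" (is "?l = ?r")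
    proof
      fix x :: real
      show "?l x = ?r x"
      proof (cases "x > 0")
        case True
        have shift: "exp (-(a * (x * v))) = exp (-((a * v) * x))" for a
          by (simp add: mult_ac)
        have "phi x * phi (x * v) = phi x * ((1 - exp (-((real N * v) * x))) / (x * v)
            - (\<Sum>m<N. exp (-((real (Suc m) * v) * x))) + exp (-((real N * v) * x)) * phi (x * v))"
          using phi_expand[of "x * v" N] True assms unfolding shift by simp
        also have "\<dots> = phi x * (1 - exp (-((real N * v) * x))) / x / v
           - phi x * (\<Sum>m<N. exp (-((real (Suc m) * v) * x))) + f x * exp (-((real N * v) * x))"
          unfolding f_def distrib_left right_diff_distrib divide_divide_eq_left times_divide_eq_right
          by (simp only: mult.assoc mult.commute)
        finally show ?thesis using True
          by (simp add: sum_distrib_left mult.commute[of "phi (x * v)"] del: of_nat_Suc)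
      qed simp
    qed
    finally show ?thesis
      by (simp add: has_bochner_integral_iff A_fun_def set_lebesgue_integral_def phi_def)
  qed
  have R0: "R \<longlonglongrightarrow> 0"
  proof (rule Lim_null_comparison)
    show "\<forall>\<^sub>F N in sequentially. norm (R N) \<le> 1 / (real N * v)"
      using eventually_gt_at_top[of 0] by eventually_elim (use R(2) in auto)
    show "(\<lambda>N. 1 / (real N * v)) \<longlonglongrightarrow> 0" using assms by real_asymp
  qed
  have "(\<lambda>N. A_fun v - R N) \<longlonglongrightarrow> A_fun v - 0"
    by (intro tendsto_intros R0)
  moreover have "eventually (\<lambda>N. A_fun v - R N = K (real N * v) / v - (\<Sum>m<N. G (real (Suc m) * v))) sequentially"
    using eventually_gt_at_top[of 0] by eventually_elim (simp only: A add_diff_cancel_right')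
  ultimately have "(\<lambda>N. K (real N * v) / v - (\<Sum>m<N. G (real (Suc m) * v))) \<longlonglongrightarrow> A_fun v - 0"
    by (rule Lim_transform_eventually)
  thus ?thesis unfolding K_def G_def by simp
qed

subsection \<open>Stirling's formula\<close>

definition psi_rem_real :: "real \<Rightarrow> real" where
  "psi_rem_real t = Digamma (t + 1) - ln t - 1 / (2 * t)"

lemma psi_rem_of_real:
  assumes "t > 0"
  shows "psi_rem (of_real t) = of_real (psi_rem_real t)"
proof -
  have "Digamma (of_real t + 1) = (of_real (Digamma (t + 1)) :: complex)"
    using Polygamma_of_real[of "t + 1" 0] assms by simp
  thus ?thesis using assms
    unfolding psi_rem_def psi_rem_real_def by (simp add: Ln_of_real)
qed

lemma abs_psi_rem_real_le:
  assumes "t \<ge> 1"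
  shows "\<bar>psi_rem_real t\<bar> \<le> 1 / t ^ 2"
proof -
  have "\<bar>psi_rem_real t\<bar> = norm (psi_rem (of_real t))"
    using assms by (simp add: psi_rem_of_real)
  also have "\<dots> \<le> (1 / t ^ 3 + 1 / (2 * t ^ 2)) / 2"
    using norm_psi_rem_le[of "of_real t"] assms by simp
  also have "1 / t ^ 3 \<le> 1 / t ^ 2"
    using assms by (intro divide_left_mono power_increasing) auto
  finally show ?thesis by (simp add: field_simps)
qed

text \<open>An antiderivative of \<open>psi_rem_real\<close>: ln Gamma(t + 1) without the growing
  terms of Stirling's formula. Its limit is the Stirling constant.\<close>

definition stirling_rem :: "real \<Rightarrow> real" where
  "stirling_rem t = ln_Gamma (t + 1) - t * ln t + t - ln t / 2"

lemma has_real_derivative_stirling_rem: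
  assumes "t > 0"
  shows "(stirling_rem has_real_derivative psi_rem_real t) (at t)"
  unfolding stirling_rem_def psi_rem_real_def using assms
  by (auto intro!: derivative_eq_intros simp: field_simps)

text \<open>The derivative is at most 1/t^2 in absolute value, so adding 1/t gives a nonincreasing
  function and subtracting it a nondecreasing one.\<close>

lemma abs_stirling_rem_diff_le:
  assumes "1 \<le> a" "a \<le> b"
  shows "\<bar>stirling_rem b - stirling_rem a\<bar> \<le> 1 / a"
proof -
  have r: "psi_rem_real t \<le> 1 / t ^ 2" "- (1 / t ^ 2) \<le> psi_rem_real t" if "t \<ge> 1" for t
    using abs_psi_rem_real_le[OF that] by auto
  have "stirling_rem b + 1 / b \<le> stirling_rem a + 1 / a"
  proof (rule DERIV_nonpos_imp_nonincreasing[OF assms(2)])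
    fix t assume t: "a \<le> t" "t \<le> b"
    have "((\<lambda>t. stirling_rem t + 1 / t) has_real_derivative psi_rem_real t - 1 / t ^ 2) (at t)"
      using assms t by (auto intro!: derivative_eq_intros has_real_derivative_stirling_rem simp: power2_eq_square)
    thus "\<exists>y. ((\<lambda>t. stirling_rem t + 1 / t) has_real_derivative y) (at t) \<and> y \<le> 0"
      using r[of t] assms t by auto
  qed
  moreover have "stirling_rem a - 1 / a \<le> stirling_rem b - 1 / b"
  proof (rule DERIV_nonneg_imp_nondecreasing[OF assms(2)])
    fix t assume t: "a \<le> t" "t \<le> b"
    have "((\<lambda>t. stirling_rem t - 1 / t) has_real_derivative psi_rem_real t + 1 / t ^ 2) (at t)"
      using assms t by (auto intro!: derivative_eq_intros has_real_derivative_stirling_rem simp: power2_eq_square)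
    thus "\<exists>y. ((\<lambda>t. stirling_rem t - 1 / t) has_real_derivative y) (at t) \<and> y \<ge> 0"
      using r[of t] assms t by (intro exI[of _ "psi_rem_real t + 1 / t ^ 2"]) auto
  qed
  moreover have "1 / b > 0" using assms by simp
  ultimately show ?thesis by linarith
qed

lemma ln_Gamma_duplication:
  fixes x :: real
  assumes "x > 0"
  shows "ln_Gamma x + ln_Gamma (x + 1 / 2) = (1 - 2 * x) * ln 2 + ln pi / 2 + ln_Gamma (2 * x)"
proof -
  have "Gamma (of_real x) * Gamma (of_real x + 1 / 2) =
          exp ((1 - 2 * of_real x) * of_real (ln 2)) * of_real (sqrt pi) * (Gamma (2 * of_real x) :: complex)"
    using assms by (intro Gamma_legendre_duplication) (auto elim!: nonpos_Ints_cases' simp: complex_eq_iff)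
  also have "Gamma (of_real x + 1 / 2 :: complex) = of_real (Gamma (x + 1 / 2))"
    by (simp flip: Gamma_complex_of_real)
  also have "Gamma (2 * of_real x :: complex) = of_real (Gamma (2 * x))"
    by (simp flip: Gamma_complex_of_real)
  also have "exp ((1 - 2 * of_real x) * of_real (ln 2) :: complex) = of_real (exp ((1 - 2 * x) * ln 2))"
    by (simp flip: exp_of_real)
  also have "Gamma (of_real x :: complex) = of_real (Gamma x)"
    by (rule Gamma_complex_of_real)
  finally have "of_real (Gamma x * Gamma (x + 1 / 2)) =
      (of_real (exp ((1 - 2 * x) * ln 2) * sqrt pi * Gamma (2 * x)) :: complex)"
    by (simp only: of_real_mult)
  hence "Gamma x * Gamma (x + 1 / 2) = exp ((1 - 2 * x) * ln 2) * sqrt pi * Gamma (2 * x)"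
    by (simp only: of_real_eq_iff)
  hence "ln (Gamma x * Gamma (x + 1 / 2)) = ln (exp ((1 - 2 * x) * ln 2) * sqrt pi * Gamma (2 * x))"
    by simp
  thus ?thesis using assms
    by (simp add: ln_mult ln_sqrt Gamma_real_pos ln_Gamma_real_pos less_imp_neq[OF Gamma_real_pos, THEN not_sym])
qed

text \<open>Legendre's formula at x = T + 1/2. In this combination all Gamma values cancel, leaving
  elementary functions of T.\<close>

lemma stirling_rem_duplication:
  assumes "T > 1"
  shows "stirling_rem (T - 1 / 2) + stirling_rem T - stirling_rem (2 * T) =
           ln (2 * pi) / 2 + T * (ln T - ln (T - 1 / 2)) - 1 / 2"
proof -
  have "ln_Gamma (T + 1 / 2) + ln_Gamma (T + 1) = - 2 * T * ln 2 + ln pi / 2 + ln_Gamma (2 * T + 1)"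
    using ln_Gamma_duplication[of "T + 1 / 2"] assms by (simp add: algebra_simps)
  moreover have "T - 1 / 2 + 1 = T + 1 / 2" by simp
  moreover have "ln (2 * T) = ln 2 + ln T" "ln (2 * pi) = ln 2 + ln pi" using assms by (simp_all add: ln_mult)
  ultimately show ?thesis
    unfolding stirling_rem_def by (simp add: algebra_simps add_divide_distrib)
qed

text \<open>The difference bound shows that a limit c exists. The duplication identity then gives c
  + c - c on one side and an explicit limit on the other.\<close>

lemma stirling_rem_tendsto: "(stirling_rem \<longlongrightarrow> ln (2 * pi) / 2) at_top"
proof -
  have "Cauchy (\<lambda>n. stirling_rem (real n))"
  proof (rule metric_CauchyI)
    fix e :: real assume e: "e > 0"
    define M where "M = Suc (nat \<lceil>2 / e\<rceil>)"
    have M: "1 / real M < e / 2" "M \<ge> 1"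
    proof -
      have "2 / e < real M" unfolding M_def by linarith
      moreover have "real M > 0" by (simp add: M_def)
      ultimately show "1 / real M < e / 2" using e by (simp add: field_simps)
    qed (simp add: M_def)
    have "dist (stirling_rem (real m)) (stirling_rem (real M)) < e / 2" if "m \<ge> M" for m
      using abs_stirling_rem_diff_le[of "real M" "real m"] that M by (simp add: dist_real_def)
    thus "\<exists>M. \<forall>m\<ge>M. \<forall>n\<ge>M. dist (stirling_rem (real m)) (stirling_rem (real n)) < e"
      by (metis dist_triangle_half_l dist_commute)
  qed
  then obtain c where c: "(\<lambda>n. stirling_rem (real n)) \<longlonglongrightarrow> c"
    using Cauchy_convergent_iff convergent_def by blast
  \<comment> \<open>Letting the upper argument run to infinity through the integers gives a rate at
    every real T, hence convergence along the reals.\<close>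
  have bound: "\<bar>c - stirling_rem T\<bar> \<le> 1 / T" if "T \<ge> 1" for T
  proof (rule LIMSEQ_le_const2)
    show "(\<lambda>n. \<bar>stirling_rem (real n) - stirling_rem T\<bar>) \<longlonglongrightarrow> \<bar>c - stirling_rem T\<bar>"
      by (intro tendsto_intros c)
    show "\<exists>N. \<forall>n\<ge>N. \<bar>stirling_rem (real n) - stirling_rem T\<bar> \<le> 1 / T"
      using that by (intro exI[of _ "nat \<lceil>T\<rceil>"] allI impI abs_stirling_rem_diff_le) linarith+
  qed
  have lim: "(stirling_rem \<longlongrightarrow> c) at_top"
  proof (rule LIM_zero_cancel, rule Lim_null_comparison)
    show "\<forall>\<^sub>F x in at_top. norm (stirling_rem x - c) \<le> 1 / x"
      using eventually_ge_at_top[of 1] by eventually_elim (use bound in \<open>auto simp: abs_minus_commute\<close>)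
    show "((\<lambda>x::real. 1 / x) \<longlongrightarrow> 0) at_top" by real_asymp
  qed
  have dup: "((\<lambda>T. stirling_rem (T - 1 / 2) + stirling_rem T - stirling_rem (2 * T)) \<longlongrightarrow> c + c - c) at_top"
    by (intro tendsto_intros filterlim_compose[OF lim]; real_asymp)
  have "((\<lambda>T. T * (ln T - ln (T - 1 / 2))) \<longlongrightarrow> 1 / 2) (at_top :: real filter)"
    by real_asymp
  hence "((\<lambda>T. ln (2 * pi) / 2 + T * (ln T - ln (T - 1 / 2)) - 1 / 2) \<longlongrightarrow> ln (2 * pi) / 2 + 1 / 2 - 1 / 2) at_top"
    by (intro tendsto_intros)
  moreover have "eventually (\<lambda>T. ln (2 * pi) / 2 + T * (ln T - ln (T - 1 / 2)) - 1 / 2 =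
      stirling_rem (T - 1 / 2) + stirling_rem T - stirling_rem (2 * T)) at_top"
    using eventually_gt_at_top[of 1] by eventually_elim (rule stirling_rem_duplication [symmetric])
  ultimately have "((\<lambda>T. stirling_rem (T - 1 / 2) + stirling_rem T - stirling_rem (2 * T))
      \<longlongrightarrow> ln (2 * pi) / 2 + 1 / 2 - 1 / 2) at_top"
    by (rule Lim_transform_eventually)
  from tendsto_unique[OF _ dup this] have "c = ln (2 * pi) / 2" by simp
  with lim show ?thesis by simp
qed

subsection \<open>Holomorphic extension and higher derivatives\<close>

lemma summable_psi_rem_bound:
  fixes d :: real
  assumes "d > 0"
  shows "summable (\<lambda>m. (1 / (real (Suc m) * d) ^ 3 + 1 / (2 * (real (Suc m) * d) ^ 2)) / 2)"
proof -
  have "summable (\<lambda>m. inverse (real (Suc m)) ^ 3 / d ^ 3 + inverse (real (Suc m)) ^ 2 / (2 * d ^ 2))"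
    unfolding power_inverse
    by (intro summable_add summable_divide inverse_power_summable[THEN summable_Suc_iff[THEN iffD2]]) auto
  hence "summable (\<lambda>m. (inverse (real (Suc m)) ^ 3 / d ^ 3 + inverse (real (Suc m)) ^ 2 / (2 * d ^ 2)) / 2)"
    by (rule summable_divide)
  thus ?thesis by (simp add: power_mult_distrib field_simps del: of_nat_Suc)
qed

text \<open>The regularised form of the limit for A. In \<open>C_const\<close>, the Stirling
  constant comes from ln Gamma, and Euler's constant from summing the removed terms 1/(2mz).\<close>

definition A_partial :: "nat \<Rightarrow> complex \<Rightarrow> complex" where
  "A_partial N z = (of_real C_const + ln z / 2) / z - (\<Sum>m<N. psi_rem (of_nat (Suc m) * z))"

definition A_complex :: "complex \<Rightarrow> complex" where
  "A_complex z = (of_real C_const + ln z / 2) / z - (\<Sum>m. psi_rem (of_nat (Suc m) * z))"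

text \<open>The bound on \<open>psi_rem\<close> involves only the real part, so the Weierstrass test
  works on a whole half-plane Re z > d.\<close>

lemma uniform_limit_A_partial:
  assumes "d > 0"
  shows "uniform_limit {z. Re z > d} A_partial A_complex sequentially"
proof -
  have "uniform_limit {z. Re z > d} (\<lambda>N z. \<Sum>m<N. psi_rem (of_nat (Suc m) * z))
      (\<lambda>z. \<Sum>m. psi_rem (of_nat (Suc m) * z)) sequentially"
  proof (rule Weierstrass_m_test[OF _ summable_psi_rem_bound[OF assms]])
    fix m z assume "z \<in> {z. Re z > d}"
    hence z: "real (Suc m) * d \<le> real (Suc m) * Re z" by (intro mult_left_mono) auto
    moreover have d: "real (Suc m) * d > 0" using assms by simp
    ultimately have pos: "real (Suc m) * Re z > 0" by linarith
    hence "Re z > 0" by (simp add: zero_less_mult_iff)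
    have Re: "Re (of_nat (Suc m) * z) = real (Suc m) * Re z"
      by (simp del: of_nat_Suc)
    have "norm (psi_rem (of_nat (Suc m) * z))
        \<le> (1 / (real (Suc m) * Re z) ^ 3 + 1 / (2 * (real (Suc m) * Re z) ^ 2)) / 2"
      using norm_psi_rem_le[of "of_nat (Suc m) * z"] pos unfolding Re by blast
    also have "\<dots> \<le> (1 / (real (Suc m) * d) ^ 3 + 1 / (2 * (real (Suc m) * d) ^ 2)) / 2"
      using z d pos \<open>Re z > 0\<close> assms by (intro divide_right_mono add_mono divide_left_mono mult_left_mono power_mono mult_pos_pos zero_less_power) auto
    finally show "norm (psi_rem (of_nat (Suc m) * z)) \<le>
        (1 / (real (Suc m) * d) ^ 3 + 1 / (2 * (real (Suc m) * d) ^ 2)) / 2" .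
  qed
  thus ?thesis unfolding A_partial_def [abs_def] A_complex_def [abs_def]
    by (intro uniform_limit_intros)
qed

section \<open>Holomorphy of the series and its agreement with A on the positive reals\<close>

lemma halfplane_not_nonpos:
  assumes "Re z > 0"
  shows "z \<notin> \<real>\<^sub>\<le>\<^sub>0" "z + 1 \<notin> \<int>\<^sub>\<le>\<^sub>0" "z \<noteq> 0"
  using assms by (auto simp: complex_nonpos_Reals_iff elim!: nonpos_Ints_cases' simp: complex_eq_iff)

lemma open_halfplane: "open {z. Re z > d}"
  by (rule open_halfspace_Re_gt)

lemma holomorphic_psi_rem: "psi_rem holomorphic_on {z. Re z > 0}"
proof -
  have "(psi_rem has_field_derivative Polygamma 1 (z + 1) - 1 / z + 1 / (2 * z ^ 2)) (at z)" if "Re z > 0" for z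
    unfolding psi_rem_def
    by (rule derivative_eq_intros refl halfplane_not_nonpos[OF that] | simp add: halfplane_not_nonpos[OF that] power2_eq_square field_simps)+
  thus ?thesis
    using open_halfplane by (auto simp: holomorphic_on_open)
qed

lemma psi_rem_scale_holomorphic: "(\<lambda>z. psi_rem (of_nat (Suc m) * z)) holomorphic_on {z. Re z > 0}"
proof -
  have "psi_rem \<circ> (\<lambda>z. of_nat (Suc m) * z) holomorphic_on {z. Re z > 0}"
    by (intro holomorphic_on_compose_gen[OF _ holomorphic_psi_rem] holomorphic_intros)
       (auto simp del: of_nat_Suc)
  thus ?thesis by (simp only: o_def)
qed

lemma main_part_holomorphic: "(\<lambda>z. (of_real C_const + ln z / 2) / z) holomorphic_on {z. Re z > 0}"
  using halfplane_not_nonpos by (intro holomorphic_intros) auto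

lemma holomorphic_A_partial: "A_partial N holomorphic_on {z. Re z > 0}"
  unfolding A_partial_def [abs_def]
  by (intro holomorphic_on_diff holomorphic_on_sum psi_rem_scale_holomorphic main_part_holomorphic)

lemma holomorphic_A_complex: "A_complex holomorphic_on {z. Re z > 0}"
proof (rule holomorphic_uniform_sequence[OF open_halfplane holomorphic_A_partial])
  fix z assume "z \<in> {z. Re z > 0}"
  hence z: "Re z > 0" by simp
  \<comment> \<open>The closed disc satisfies only Re w >= Re z / 2, so a smaller bound is used for
    the open half-plane of uniform convergence.\<close>
  have "cball z (Re z / 2) \<subseteq> {w. Re w > Re z / 4}"
  proof
    fix w assume "w \<in> cball z (Re z / 2)"
    hence "Re (z - w) \<le> Re z / 2"
      using complex_Re_le_cmod[of "z - w"] by (simp add: dist_norm)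
    thus "w \<in> {w. Re w > Re z / 4}" using z by simp
  qed
  moreover from this have "cball z (Re z / 2) \<subseteq> {w. Re w > 0}" using z by (auto dest!: subsetD)
  ultimately show "\<exists>d>0. cball z d \<subseteq> {z. Re z > 0} \<and> uniform_limit (cball z d) A_partial A_complex sequentially"
    using z by (intro exI[of _ "Re z / 2"] conjI uniform_limit_on_subset[OF uniform_limit_A_partial[of "Re z / 4"]]) auto
qed

lemma A_complex_of_real:
  assumes "v > 0"
  shows "A_complex (of_real v) = of_real (A_fun v)"
proof -
  have "(\<lambda>N. A_partial N (of_real v)) \<longlonglongrightarrow> A_complex (of_real v)"
    using assms by (intro tendsto_uniform_limitI[OF uniform_limit_A_partial[of "v / 2"]]) auto
  moreover have "A_partial N (of_real v) = of_real ((C_const + ln v / 2) / v - (\<Sum>m<N. psi_rem_real (real (Suc m) * v)))" for N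
  proof -
    have "psi_rem (of_nat (Suc m) * of_real v) = of_real (psi_rem_real (real (Suc m) * v))" for m
      using psi_rem_of_real[of "real (Suc m) * v"] assms by simp
    thus ?thesis using assms by (simp add: A_partial_def Ln_of_real del: of_nat_Suc)
  qed
  moreover have "(\<lambda>N. (C_const + ln v / 2) / v - (\<Sum>m<N. psi_rem_real (real (Suc m) * v))) \<longlonglongrightarrow> A_fun v"
  proof -
    define a where "a N = (ln_Gamma (real N * v + 1) - real N * v * ln (real N * v) + real N * v) / v
            - (\<Sum>m<N. Digamma (real (Suc m) * v + 1) - ln (real (Suc m) * v))" for N
    \<comment> \<open>The sequence with limit A(v) and the partial sums of the regularised series
      differ by two null sequences: the error in Stirling's formula and the error in the limit
      defining Euler's constant.\<close>
    have eq: "a N - (stirling_rem (real N * v) - ln (2 * pi) / 2) / v + ((harm N - ln (real N)) - euler_mascheroni) / (2 * v)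
      = (C_const + ln v / 2) / v - (\<Sum>m<N. psi_rem_real (real (Suc m) * v))" if "N > 0" for N
    proof -
      have "(\<Sum>m<N. psi_rem_real (real (Suc m) * v)) =
          (\<Sum>m<N. Digamma (real (Suc m) * v + 1) - ln (real (Suc m) * v)) - (\<Sum>m<N. inverse (real (Suc m)) / (2 * v))"
        unfolding psi_rem_real_def sum_subtractf [symmetric] by (intro sum.cong) (auto simp: field_simps)
      also have "(\<Sum>m<N. inverse (real (Suc m)) / (2 * v)) = harm N / (2 * v)"
        by (simp add: harm_altdef sum_divide_distrib)
      moreover have "ln (real N * v) = ln (real N) + ln v" using that assms by (simp add: ln_mult)
      ultimately show ?thesis
        unfolding a_def stirling_rem_def C_const_def using assms
        by (simp add: add_divide_distrib diff_divide_distrib)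
    qed
    have "(\<lambda>N. stirling_rem (real N * v)) \<longlonglongrightarrow> ln (2 * pi) / 2"
      by (rule filterlim_compose[OF stirling_rem_tendsto]) (use assms in real_asymp)
    moreover have "a \<longlonglongrightarrow> A_fun v" unfolding a_def using A_fun_LIMSEQ[OF assms] .
    ultimately have "(\<lambda>N. a N - (stirling_rem (real N * v) - ln (2 * pi) / 2) / v + ((harm N - ln (real N)) - euler_mascheroni) / (2 * v))
       \<longlonglongrightarrow> A_fun v - (ln (2 * pi) / 2 - ln (2 * pi) / 2) / v + (euler_mascheroni - euler_mascheroni) / (2 * v)"
      using assms by (intro tendsto_intros euler_mascheroni_LIMSEQ) auto
    hence "(\<lambda>N. a N - (stirling_rem (real N * v) - ln (2 * pi) / 2) / v + ((harm N - ln (real N)) - euler_mascheroni) / (2 * v))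
       \<longlonglongrightarrow> A_fun v" by simp
    thus ?thesis
      by (rule Lim_transform_eventually) (rule eventually_mono[OF eventually_gt_at_top[of 0] eq])
  qed
  hence "(\<lambda>N. of_real ((C_const + ln v / 2) / v - (\<Sum>m<N. psi_rem_real (real (Suc m) * v)))) \<longlonglongrightarrow> complex_of_real (A_fun v)"
    by (rule tendsto_of_real)
  ultimately show ?thesis by (simp add: LIMSEQ_unique)
qed

section \<open>From complex derivatives to real derivatives\<close>

lemma has_field_derivative_of_real_restrict:
  assumes "(f has_field_derivative D) (at (of_real v))"
    and "eventually (\<lambda>x. f (of_real x) = complex_of_real (b x)) (nhds v)"
  shows "(b has_real_derivative Re D) (at v)" "D = of_real (Re D)"
proof -
  have d: "((\<lambda>x. f (of_real x)) has_vector_derivative D) (at v)"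
    using has_vector_derivative_real_field[OF assms(1)] by simp
  have Re: "((\<lambda>x. Re (f (of_real x))) has_real_derivative Re D) (at v)"
    using bounded_linear.has_vector_derivative[OF bounded_linear_Re d]
    by (simp add: has_real_derivative_iff_has_vector_derivative)
  have Im: "((\<lambda>x. Im (f (of_real x))) has_real_derivative Im D) (at v)"
    using bounded_linear.has_vector_derivative[OF bounded_linear_Im d]
    by (simp add: has_real_derivative_iff_has_vector_derivative)
  have ev: "eventually (\<lambda>x. Re (f (of_real x)) = b x) (nhds v)"
    "eventually (\<lambda>x. Im (f (of_real x)) = 0) (nhds v)"
    using assms(2) by (eventually_elim, simp)+
  show "(b has_real_derivative Re D) (at v)"
    using Re by (rule DERIV_cong_ev[OF refl ev(1) refl, THEN iffD1])
  \<comment> \<open>The imaginary part vanishes along the real axis near v, which forces D to be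
    real.\<close>
  have "((\<lambda>_. 0) has_real_derivative Im D) (at v)"
    using Im by (rule DERIV_cong_ev[OF refl ev(2) refl, THEN iffD1])
  hence "Im D = 0" using DERIV_unique DERIV_const by blast
  thus "D = of_real (Re D)" by (simp add: complex_eq_iff)
qed

lemma higher_deriv_of_real_restrict:
  assumes holo: "f holomorphic_on S" and S: "open S" "\<And>v. v > 0 \<Longrightarrow> of_real v \<in> S"
    and eq: "\<And>v. v > 0 \<Longrightarrow> f (of_real v) = of_real (b v)"
    and "v > 0"
  shows "(deriv ^^ k) f (of_real v) = of_real ((deriv ^^ k) b v)"
    and "(deriv ^^ k) b differentiable (at v)"
proof -
  have D: "((deriv ^^ k) f has_field_derivative deriv ((deriv ^^ k) f) (of_real v)) (at (of_real v))" if "v > 0" for k v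
    using holomorphic_higher_deriv[OF holo S(1)] S that
    by (intro holomorphic_derivI[OF _ S(1)]) auto
  have ev: "eventually (\<lambda>x. x > 0) (nhds v)" if "v > 0" for v :: real
    using that by (intro eventually_nhds_in_open[of "{0<..}", simplified]) auto
  have *: "(deriv ^^ k) f (of_real v) = of_real ((deriv ^^ k) b v)" if "v > 0" for k v
    using that
  proof (induction k arbitrary: v)
    case (Suc k)
    \<comment> \<open>Differentiating needs equality near v, not just at v; the induction hypothesis
      supplies it at all positive reals.\<close>
    from ev[OF Suc.prems] have "eventually (\<lambda>x. (deriv ^^ k) f (of_real x) = of_real ((deriv ^^ k) b x)) (nhds v)"
      by eventually_elim (rule Suc.IH)
    from has_field_derivative_of_real_restrict[OF D[OF Suc.prems] this]
    show ?case by (metis DERIV_imp_deriv comp_apply funpow.simps(2))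
  qed (use eq in auto)
  thus "(deriv ^^ k) f (of_real v) = of_real ((deriv ^^ k) b v)" using \<open>v > 0\<close> .
  from ev[OF \<open>v > 0\<close>] have "eventually (\<lambda>x. (deriv ^^ k) f (of_real x) = of_real ((deriv ^^ k) b x)) (nhds v)"
    by eventually_elim (rule *)
  from has_field_derivative_of_real_restrict(1)[OF D[OF \<open>v > 0\<close>] this]
  show "(deriv ^^ k) b differentiable (at v)"
    by (auto simp: real_differentiable_def)
qed

section \<open>Closed forms and bounds for the higher derivatives\<close>

lemma higher_deriv_eqI:
  fixes f :: "nat \<Rightarrow> 'a :: real_normed_field \<Rightarrow> 'a"
  assumes "open S" "\<And>k z. z \<in> S \<Longrightarrow> (f k has_field_derivative f (Suc k) z) (at z)" "z \<in> S"
  shows "(deriv ^^ k) (f 0) z = f k z"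
  using assms(3)
proof (induction k arbitrary: z)
  case (Suc k)
  have "eventually (\<lambda>w. w \<in> S) (nhds z)" using Suc assms(1) by (intro eventually_nhds_in_open)
  hence "eventually (\<lambda>w. (deriv ^^ k) (f 0) w = f k w) (nhds z)"
    by eventually_elim (rule Suc.IH)
  hence "deriv ((deriv ^^ k) (f 0)) z = deriv (f k) z" by (intro deriv_cong_ev refl)
  also have "\<dots> = f (Suc k) z" by (intro DERIV_imp_deriv assms(2) Suc.prems)
  finally show ?case by simp
qed auto

lemma higher_deriv_main_part:
  assumes "Re z > 0"
  shows "(deriv ^^ k) (\<lambda>z. (of_real C_const + ln z / 2) / z) z =
           (-1) ^ k * fact k * (of_real C_const + ln z / 2 - of_real (harm k) / 2) / z ^ Suc k"
proof -
  define f where "f k z = (-1) ^ k * fact k * (of_real C_const + ln z / 2 - of_real (harm k) / 2) / z ^ Suc k"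
    for k and z :: complex
  have "(f k has_field_derivative f (Suc k) w) (at w)" if "w \<in> {z. Re z > 0}" for k w
  proof -
    from that have w: "Re w > 0" by simp
    note nz = halfplane_not_nonpos[OF w]
    define c where "c = of_real C_const + ln w / 2 - of_real (harm k) / 2"
    have "(f k has_field_derivative ((-1) ^ k * fact k * (1 / w / 2) * w ^ Suc k
        - (-1) ^ k * fact k * c * (of_nat (Suc k) * w ^ k)) / (w ^ Suc k * w ^ Suc k)) (at w)"
      unfolding f_def c_def using nz
      by (auto intro!: derivative_eq_intros simp del: of_nat_Suc power_Suc simp: inverse_eq_divide)
    also have "(-1) ^ k * fact k * (1 / w / 2) * w ^ Suc k - (-1) ^ k * fact k * c * (of_nat (Suc k) * w ^ k)
        = w ^ k * ((-1) ^ k * fact k * (1 / 2 - c * of_nat (Suc k)))"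
      using nz by (simp add: right_diff_distrib mult_ac del: of_nat_Suc)
    also have "w ^ Suc k * w ^ Suc k = w ^ k * w ^ Suc (Suc k)"
      by (simp add: mult_ac)
    also have "w ^ k * ((-1) ^ k * fact k * (1 / 2 - c * of_nat (Suc k))) / (w ^ k * w ^ Suc (Suc k)) =
        (-1) ^ k * fact k * (1 / 2 - c * of_nat (Suc k)) / w ^ Suc (Suc k)"
      using nz by (intro mult_divide_mult_cancel_left) simp
    \<comment> \<open>Here the harmonic number arises: each derivative of the logarithm lowers the
      constant by 1/(2(k + 1)).\<close>
    also have "1 / 2 - c * of_nat (Suc k) = - of_nat (Suc k) * (of_real C_const + ln w / 2 - of_real (harm (Suc k)) / 2)"
    proof -
      have "of_real (harm (Suc k)) = of_real (harm k) + 1 / (of_nat (Suc k) :: complex)"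
        by (simp add: harm_Suc inverse_eq_divide)
      hence "of_real C_const + ln w / 2 - of_real (harm (Suc k)) / 2 = c - 1 / of_nat (Suc k) / 2"
        unfolding c_def by (simp add: add_divide_distrib del: of_nat_Suc)
      moreover have "1 / 2 - c * n = - n * (c - 1 / n / 2)" if "n \<noteq> 0" for n
        using that by (simp add: right_diff_distrib mult.commute)
      ultimately show ?thesis by (simp only: of_nat_neq_0 not_False_eq_True)
    qed
    also have "(-1) ^ k * fact k * (- of_nat (Suc k) * (of_real C_const + ln w / 2 - of_real (harm (Suc k)) / 2)) / w ^ Suc (Suc k) = f (Suc k) w"
      unfolding f_def by (simp add: mult_ac del: of_nat_Suc)
    finally show ?thesis .
  qed
  from higher_deriv_eqI[where f = f and S = "{z. Re z > 0}", OF open_halfplane this, of z k] assms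
  have "(deriv ^^ k) (f 0) z = f k z" by simp
  moreover have "f 0 = (\<lambda>z. (of_real C_const + ln z / 2) / z)" by (simp add: f_def fun_eq_iff harm_def)
  ultimately show ?thesis by (simp only: f_def)
qed

lemma has_field_derivative_divide_power:
  fixes z :: "'a :: real_normed_field"
  assumes "z \<noteq> 0"
  shows "((\<lambda>z. c / z ^ Suc n) has_field_derivative - (of_nat (Suc n) * c / z ^ Suc (Suc n))) (at z)"
proof -
  have "((\<lambda>z. c / z ^ Suc n) has_field_derivative (0 * z ^ Suc n - c * (of_nat (Suc n) * 1 * z ^ n)) / (z ^ Suc n * z ^ Suc n)) (at z)"
    using assms DERIV_power[where n = "Suc n", OF DERIV_ident[of "at z"]]
    by (intro DERIV_divide DERIV_const) (simp_all del: of_nat_Suc power_Suc)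
  also have "0 * z ^ Suc n - c * (of_nat (Suc n) * 1 * z ^ n) = z ^ n * (- (of_nat (Suc n) * c))"
    by (simp add: mult_ac del: of_nat_Suc)
  also have "z ^ Suc n * z ^ Suc n = z ^ n * z ^ Suc (Suc n)"
    by (simp add: mult_ac)
  also have "z ^ n * (- (of_nat (Suc n) * c)) / (z ^ n * z ^ Suc (Suc n)) = - (of_nat (Suc n) * c) / z ^ Suc (Suc n)"
    using assms by (intro mult_divide_mult_cancel_left) simp
  finally show ?thesis by simp
qed

lemma higher_deriv_psi_rem:
  assumes "Re z > 0"
  shows "(deriv ^^ Suc k) psi_rem z =
           Polygamma (Suc k) (z + 1) - (-1) ^ k * fact k / z ^ Suc k
             + (-1) ^ k * fact (Suc k) / (2 * z ^ Suc (Suc k))"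
proof -
  \<comment> \<open>The closed form starts at order 1, where the logarithm has become a power of z;
    order 0 is \<open>psi_rem\<close> itself.\<close>
  define f where "f k z = (case k of 0 \<Rightarrow> psi_rem z | Suc k \<Rightarrow>
     Polygamma (Suc k) (z + 1) - (-1) ^ k * fact k / z ^ Suc k
             + (-1) ^ k * fact (Suc k) / (2 * z ^ Suc (Suc k)))" for k and z :: complex
  have "(f k has_field_derivative f (Suc k) w) (at w)" if "w \<in> {z. Re z > 0}" for k w
  proof -
    from that have w: "Re w > 0" by simp
    note nz = halfplane_not_nonpos[OF w]
    show ?thesis
    proof (cases k)
      case 0
      have "(psi_rem has_field_derivative Polygamma 1 (w + 1) - 1 / w + 1 / (2 * w ^ 2)) (at w)"
        unfolding psi_rem_def
        by (rule derivative_eq_intros refl nz | simp add: nz power2_eq_square field_simps)+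
      moreover have "f 0 = psi_rem" by (simp add: f_def fun_eq_iff)
      ultimately show ?thesis by (simp add: f_def 0 power2_eq_square)
    next
      case (Suc j)
      have "w + 1 \<notin> \<int>\<^sub>\<le>\<^sub>0" by (rule nz)
      hence "((\<lambda>z. Polygamma (Suc j) (z + 1)) has_field_derivative Polygamma (Suc (Suc j)) (w + 1)) (at w)"
        by (intro DERIV_shift[THEN iffD1] has_field_derivative_Polygamma)
      hence "((\<lambda>z. Polygamma (Suc j) (z + 1) - (-1) ^ j * fact j / z ^ Suc j + (-1) ^ j * fact (Suc j) / 2 / z ^ Suc (Suc j))
          has_field_derivative Polygamma (Suc (Suc j)) (w + 1) - - (of_nat (Suc j) * ((-1) ^ j * fact j) / w ^ Suc (Suc j))
           + - (of_nat (Suc (Suc j)) * ((-1) ^ j * fact (Suc j) / 2) / w ^ Suc (Suc (Suc j)))) (at w)"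
        using nz by (intro DERIV_add DERIV_diff has_field_derivative_divide_power)
      also have "of_nat (Suc j) * ((-1) ^ j * fact j) = - ((-1) ^ Suc j * fact (Suc j) :: complex)"
        by (simp only: fact_Suc) simp
      also have "of_nat (Suc (Suc j)) * ((-1) ^ j * fact (Suc j) / 2) = - ((-1) ^ Suc j * fact (Suc (Suc j)) / 2 :: complex)"
        by (simp only: fact_Suc[of "Suc j"]) (simp del: fact_Suc of_nat_Suc)
      finally show ?thesis unfolding Suc f_def nat.case by (simp del: fact_Suc power_Suc)
    qed
  qed
  from higher_deriv_eqI[where f = f and S = "{z. Re z > 0}", OF open_halfplane this, of z "Suc k"] assms
  have "(deriv ^^ Suc k) (f 0) z = f (Suc k) z" by simp
  moreover have "f 0 = psi_rem" by (simp add: f_def fun_eq_iff)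
  ultimately show ?thesis by (simp only: f_def nat.case)
qed

text \<open>Cauchy's inequality on the disc of radius \<open>m/2\<close> transfers the decay of \<open>psi_rem\<close> to its derivatives.\<close>

lemma norm_higher_deriv_psi_rem_le:
  assumes "m > 0"
  shows "norm (of_nat m ^ k * (deriv ^^ k) psi_rem (of_nat m)) \<le> fact k * 2 ^ k * (5 / real m ^ 2)"
proof -
  define r where "r = real m / 2"
  have r: "r > 0" using assms by (simp add: r_def)
  have Re: "Re w \<ge> r" if "norm (of_nat m - w) \<le> r" for w
    using complex_Re_le_cmod[of "of_nat m - w"] that by (simp add: r_def)
  have holo: "psi_rem holomorphic_on cball (of_nat m) r"
    by (rule holomorphic_on_subset[OF holomorphic_psi_rem]) (use Re r in \<open>force simp: dist_norm\<close>)
  have "norm ((deriv ^^ k) psi_rem (of_nat m)) \<le> fact k * (5 / real m ^ 2) / r ^ k"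
  proof (rule Cauchy_inequality)
    show "psi_rem holomorphic_on ball (of_nat m) r"
      using holo by (rule holomorphic_on_subset) auto
    show "continuous_on (cball (of_nat m) r) psi_rem"
      using holo by (rule holomorphic_on_imp_continuous_on)
    fix w :: complex assume "norm (of_nat m - w) = r"
    hence w: "Re w \<ge> r" by (intro Re) simp
    have "norm (psi_rem w) \<le> (1 / Re w ^ 3 + 1 / (2 * Re w ^ 2)) / 2"
      using w r by (intro norm_psi_rem_le) auto
    also have "\<dots> \<le> (1 / r ^ 3 + 1 / (2 * r ^ 2)) / 2"
      using w r by (intro divide_right_mono add_mono divide_left_mono mult_left_mono power_mono mult_pos_pos zero_less_power) auto
    also have "\<dots> = (4 / real m + 1) / real m ^ 2"
      using assms by (simp add: r_def field_simps power2_eq_square power3_eq_cube)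
    \<comment> \<open>Here 4/m + 1 <= 5 because m >= 1.\<close>
    also have "\<dots> \<le> 5 / real m ^ 2"
      using assms by (intro divide_right_mono) (auto simp: field_simps)
    finally show "norm (psi_rem w) \<le> 5 / real m ^ 2" .
  qed (rule r)
  hence "real m ^ k * norm ((deriv ^^ k) psi_rem (of_nat m)) \<le> real m ^ k * (fact k * (5 / real m ^ 2) / r ^ k)"
    by (intro mult_left_mono) auto
  also have "\<dots> = fact k * 2 ^ k * (5 / real m ^ 2)"
    using assms by (simp add: r_def power_divide)
  finally show ?thesis by (simp only: norm_mult norm_power norm_of_nat)
qed

text \<open>Uniform convergence of holomorphic functions carries over to derivatives, so the series
  may be differentiated termwise. The chain rule for z -> mz produces the factor m^k.\<close>

lemma higher_deriv_A_fun_LIMSEQ: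
  "(\<lambda>N. (-1) ^ k * fact k * (of_real C_const - of_real (harm k) / 2)
      - (\<Sum>m<N. of_nat (Suc m) ^ k * (deriv ^^ k) psi_rem (of_nat (Suc m)))) \<longlonglongrightarrow> complex_of_real ((deriv ^^ k) A_fun 1)"
proof -
  have "(\<lambda>N. (deriv ^^ k) (A_partial N) 1) \<longlonglongrightarrow> (deriv ^^ k) A_complex 1"
  proof (rule higher_deriv_complex_uniform_limit)
    show "uniform_limit {z. Re z > 1 / 2} A_partial A_complex sequentially"
      by (rule uniform_limit_A_partial) simp
    show "\<forall>\<^sub>F n in sequentially. A_partial n holomorphic_on {z. Re z > 1 / 2}"
      by (intro always_eventually allI holomorphic_on_subset[OF holomorphic_A_partial]) auto
  qed (use open_halfplane[of "1 / 2"] in simp_all)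
  moreover have "(deriv ^^ k) A_complex (of_real 1) = of_real ((deriv ^^ k) A_fun 1)"
    by (rule higher_deriv_of_real_restrict(1)[OF holomorphic_A_complex open_halfplane _ A_complex_of_real]) simp_all
  moreover have "(deriv ^^ k) (A_partial N) 1 = (-1) ^ k * fact k * (of_real C_const - of_real (harm k) / 2)
      - (\<Sum>m<N. of_nat (Suc m) ^ k * (deriv ^^ k) psi_rem (of_nat (Suc m)))" for N
  proof -
    have sum: "(deriv ^^ k) (\<lambda>z. \<Sum>m<N. psi_rem (of_nat (Suc m) * z)) 1 =
       (\<Sum>m<N. (deriv ^^ k) (\<lambda>z. psi_rem (of_nat (Suc m) * z)) 1)"
    proof (induction N)
      case (Suc N)
      have "(deriv ^^ k) (\<lambda>z. (\<Sum>m<N. psi_rem (of_nat (Suc m) * z)) + psi_rem (of_nat (Suc N) * z)) 1 =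
         (deriv ^^ k) (\<lambda>z. (\<Sum>m<N. psi_rem (of_nat (Suc m) * z))) 1 + (deriv ^^ k) (\<lambda>z. psi_rem (of_nat (Suc N) * z)) 1"
        by (rule higher_deriv_add[where S = "{z. Re z > 0}"])
           (intro holomorphic_on_sum psi_rem_scale_holomorphic open_halfplane | simp)+
      thus ?case using Suc by simp
    qed simp
    have "(deriv ^^ k) (A_partial N) 1 = (deriv ^^ k) (\<lambda>z. (of_real C_const + ln z / 2) / z) 1
       - (deriv ^^ k) (\<lambda>z. \<Sum>m<N. psi_rem (of_nat (Suc m) * z)) 1"
      unfolding A_partial_def [abs_def]
      by (rule higher_deriv_diff[where S = "{z. Re z > 0}"])
         (intro main_part_holomorphic holomorphic_on_sum psi_rem_scale_holomorphic open_halfplane | simp)+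
    also have "(deriv ^^ k) (\<lambda>z. \<Sum>m<N. psi_rem (of_nat (Suc m) * z)) 1 =
       (\<Sum>m<N. of_nat (Suc m) ^ k * (deriv ^^ k) psi_rem (of_nat (Suc m)))"
      unfolding sum
    proof (intro sum.cong refl)
      fix m
      have "(deriv ^^ k) (\<lambda>z. psi_rem (of_nat (Suc m) * z)) 1 = of_nat (Suc m) ^ k * (deriv ^^ k) psi_rem (of_nat (Suc m) * 1)"
        by (rule higher_deriv_compose_linear[OF holomorphic_psi_rem open_halfplane[of 0] open_halfplane[of 0]])
           (simp_all del: of_nat_Suc)
      thus "(deriv ^^ k) (\<lambda>z. psi_rem (of_nat (Suc m) * z)) 1 = of_nat (Suc m) ^ k * (deriv ^^ k) psi_rem (of_nat (Suc m))"
        by (simp only: mult_1_right)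
    qed
    also have "(deriv ^^ k) (\<lambda>z. (complex_of_real C_const + ln z / 2) / z) 1 = (-1) ^ k * fact k * (of_real C_const - of_real (harm k) / 2)"
      using higher_deriv_main_part[of 1 k] by simp
    finally show ?thesis .
  qed
  ultimately show ?thesis by simp
qed

subsection \<open>Evaluation at 1\<close>

text \<open>For k > 0 this is the Hurwitz zeta value zeta(k + 1, m + 1), the sum of r^(-k-1) over r
  > m, in the shape of the series for \<open>Polygamma k\<close> at m + 1.\<close>

definition power_tail :: "nat \<Rightarrow> nat \<Rightarrow> real" where
  "power_tail k m = (\<Sum>j. inverse ((real m + 1 + real j) ^ Suc k))"

lemma power_tail_Suc:
  assumes "k > 0"
  shows "power_tail k m = 1 / real (Suc m) ^ Suc k + power_tail k (Suc m)"
proof -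
  have "summable (\<lambda>j. inverse ((real m + 1 + real j) ^ Suc k))"
    using Polygamma_converges'[of "real m + 1" "Suc k"] assms by simp
  from suminf_split_head[OF this] show ?thesis
    unfolding power_tail_def by (simp add: add_ac inverse_eq_divide del: power_Suc)
qed

text \<open>The terms 1/k - 1/(2m) are the start of the expansion of m^k times the tail: the
  integral of x^(-k-1) from m on, and half the boundary term.\<close>

definition tail_rem :: "nat \<Rightarrow> nat \<Rightarrow> real" where
  "tail_rem k m = real m ^ k * power_tail k m - 1 / real k + 1 / (2 * real m)"

lemma higher_deriv_psi_rem_of_nat:
  assumes "k > 0" "m > 0"
  shows "of_nat m ^ k * (deriv ^^ k) psi_rem (of_nat m) = of_real (- ((-1) ^ k * fact k * tail_rem k m))"
proof -
  obtain j where k: "k = Suc j" using assms by (cases k) auto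
  have "Polygamma k (of_nat m + 1) = complex_of_real (Polygamma k (real m + 1))"
    using Polygamma_of_real[of "real m + 1" k] by simp
  also have "Polygamma k (real m + 1) = (-1) ^ Suc k * fact k * power_tail k m"
    using assms by (simp add: Polygamma_def power_tail_def)
  finally have P: "Polygamma (Suc j) (of_nat m + 1) = complex_of_real ((-1) ^ j * fact k * power_tail k m)"
    by (simp add: k)
  define X where "X = (-1) ^ j * fact k * power_tail k m - (-1) ^ j * fact j / real m ^ k
       + (-1) ^ j * fact k / (2 * real m ^ Suc k)"
  have D: "(deriv ^^ k) psi_rem (of_nat m) = of_real X"
    using higher_deriv_psi_rem[of "of_nat m" j] assms unfolding k P X_def by (simp del: fact_Suc power_Suc)
  have "real m ^ k * X = - ((-1) ^ k * fact k * tail_rem k m)"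
  proof -
    have "fact k = real k * (fact j :: real)" by (simp add: k)
    hence "(-1) ^ j * fact k * tail_rem k m = (-1) ^ j * (real m ^ k * (fact k * power_tail k m) - fact j + fact k / (2 * real m))"
      using assms by (simp add: tail_rem_def algebra_simps)
    also have "\<dots> = real m ^ k * X"
      unfolding X_def using assms by (simp add: distrib_left right_diff_distrib mult_ac)
    finally show ?thesis by (simp add: k)
  qed
  moreover have "of_nat m ^ k * (deriv ^^ k) psi_rem (of_nat m) = of_real (real m ^ k * X)"
    by (simp add: D)
  ultimately show ?thesis by (simp only:)
qed

text \<open>Cauchy's estimate for the derivatives of \<open>psi_rem\<close> is read as an estimate
  for the tails of the zeta series.\<close>

lemma abs_tail_rem_le:
  assumes "k > 0" "m > 0"
  shows "\<bar>tail_rem k m\<bar> \<le> 2 ^ k * (5 / real m ^ 2)"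
proof -
  have "fact k * \<bar>tail_rem k m\<bar> \<le> fact k * (2 ^ k * (5 / real m ^ 2))"
    using norm_higher_deriv_psi_rem_le[OF assms(2), of k]
    unfolding higher_deriv_psi_rem_of_nat[OF assms] norm_of_real
    by (simp add: abs_mult power_abs mult_ac)
  thus ?thesis by (simp only: mult_le_cancel_left_pos fact_gt_zero)
qed

lemma higher_deriv_A_fun_LIMSEQ_real:
  assumes "k > 0"
  shows "(\<lambda>N. (-1) ^ k * fact k * (C_const - harm k / 2 + (\<Sum>m<N. tail_rem k (Suc m)))) \<longlonglongrightarrow> (deriv ^^ k) A_fun 1"
proof -
  have "(\<lambda>N. complex_of_real ((-1) ^ k * fact k * (C_const - harm k / 2 + (\<Sum>m<N. tail_rem k (Suc m)))))
       \<longlonglongrightarrow> complex_of_real ((deriv ^^ k) A_fun 1)"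
    using higher_deriv_A_fun_LIMSEQ[of k] assms
    by (simp add: higher_deriv_psi_rem_of_nat distrib_left sum_distrib_left sum_negf del: of_nat_Suc)
  thus ?thesis by (simp only: tendsto_of_real_iff)
qed

text \<open>Exchange of summation: for r <= N the term r^(-k-1) is paired with all m < r, and the
  terms with r > N are paired with every m <= N. Induction on N peels one term off the tail, so only
  finite sums are rearranged.\<close>

lemma sum_power_times_tail:
  assumes "k > 0"
  shows "(\<Sum>m<N. real (Suc m) ^ k * power_tail k (Suc m)) =
           (\<Sum>r<N. (\<Sum>m<Suc r. real m ^ k) / real (Suc r) ^ Suc k) + (\<Sum>m<Suc N. real m ^ k) * power_tail k N"
proof (induction N)
  case 0
  thus ?case using assms by simp
next
  case (Suc N)
  define S where "S = (\<Sum>m<Suc N. real m ^ k)"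
  have "(\<Sum>m<Suc N. real (Suc m) ^ k * power_tail k (Suc m)) =
     (\<Sum>r<N. (\<Sum>m<Suc r. real m ^ k) / real (Suc r) ^ Suc k) + S * power_tail k N + real (Suc N) ^ k * power_tail k (Suc N)"
    unfolding sum.lessThan_Suc[of _ N] Suc.IH S_def ..
  also have "S * power_tail k N = S / real (Suc N) ^ Suc k + S * power_tail k (Suc N)"
    unfolding power_tail_Suc[OF assms, of N] by (simp add: distrib_left del: power_Suc of_nat_Suc)
  also have "(\<Sum>r<N. (\<Sum>m<Suc r. real m ^ k) / real (Suc r) ^ Suc k) + (S / real (Suc N) ^ Suc k + S * power_tail k (Suc N)) + real (Suc N) ^ k * power_tail k (Suc N)
     = ((\<Sum>r<N. (\<Sum>m<Suc r. real m ^ k) / real (Suc r) ^ Suc k) + S / real (Suc N) ^ Suc k) + (S + real (Suc N) ^ k) * power_tail k (Suc N)"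
    by (simp add: distrib_right del: power_Suc of_nat_Suc)
  finally show ?case
    unfolding S_def sum.lessThan_Suc[of _ N] sum.lessThan_Suc[of _ "Suc N"] .
qed

definition bern_coeff :: "nat \<Rightarrow> nat \<Rightarrow> real" where
  "bern_coeff k j = real (k choose (j - 1)) * bernoulli_num j / real j"

lemma sum_powers_over_power:
  assumes "k > 0" "n > 0"
  shows "(\<Sum>m<n. real m ^ k) / real n ^ Suc k =
           1 / real (Suc k) - 1 / real n / 2 + (\<Sum>j=2..k. bern_coeff k j * (1 / real n ^ j))"
proof -
  have "(\<Sum>m<n. real m ^ k) / real n ^ Suc k =
     (\<Sum>l\<le>k. real (Suc k choose l) / real (Suc k) * bernoulli_num l * (1 / real n ^ l))"
    unfolding sum_powers_bernoulli sum_divide_distrib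
  proof (intro sum.cong refl)
    fix l assume "l \<in> {..k}"
    hence "real n ^ Suc k = real n ^ (Suc k - l) * real n ^ l" by (simp flip: power_add)
    thus "real (Suc k choose l) * bernoulli_num l * real n ^ (Suc k - l) / real (Suc k) / real n ^ Suc k =
      real (Suc k choose l) / real (Suc k) * bernoulli_num l * (1 / real n ^ l)"
      using assms by (simp del: power_Suc of_nat_Suc binomial_Suc_Suc)
  qed
  \<comment> \<open>The terms for B_0 = 1 and B_1 = -1/2 give 1/(k + 1) and -1/(2n).\<close>
  also have "{..k} = insert 0 (insert 1 {2..k})" using assms by auto
  also have "(\<Sum>l\<in>\<dots>. real (Suc k choose l) / real (Suc k) * bernoulli_num l * (1 / real n ^ l)) =
      1 / real (Suc k) - 1 / real n / 2 + (\<Sum>l=2..k. real (Suc k choose l) / real (Suc k) * bernoulli_num l * (1 / real n ^ l))"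
    by simp
  also have "(\<Sum>l=2..k. real (Suc k choose l) / real (Suc k) * bernoulli_num l * (1 / real n ^ l)) =
     (\<Sum>j=2..k. bern_coeff k j * (1 / real n ^ j))"
  proof (intro sum.cong refl)
    fix l assume "l \<in> {2..k}"
    then obtain i where l: "l = Suc i" by (cases l) auto
    \<comment> \<open>This absorption identity changes the coefficients of the power sum formula
      into those of the claim.\<close>
    have "Suc i * (Suc k choose Suc i) = Suc k * (k choose i)"
      using Suc_times_binomial_eq[of k i] by (simp only: mult.commute)
    hence "real (Suc i) * real (Suc k choose Suc i) = real (Suc k) * real (k choose i)"
      by (simp only: flip: of_nat_mult)
    hence "real (Suc k choose l) / real (Suc k) = real (k choose (l - 1)) / real l"
      unfolding l by (simp add: field_simps del: of_nat_Suc binomial_Suc_Suc)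
    thus "real (Suc k choose l) / real (Suc k) * bernoulli_num l * (1 / real n ^ l) = bern_coeff k l * (1 / real n ^ l)"
      by (simp add: bern_coeff_def)
  qed
  finally show ?thesis .
qed

lemma zeta_real_LIMSEQ:
  assumes "j \<ge> 2"
  shows "(\<lambda>N. \<Sum>r<N. 1 / real (Suc r) ^ j) \<longlonglongrightarrow> zeta_real (real j)"
proof -
  have "summable (\<lambda>r. inverse (real (Suc r) ^ j))"
    by (intro inverse_power_summable[THEN summable_Suc_iff[THEN iffD2]] assms)
  hence "summable (\<lambda>r. 1 / real (Suc r) ^ j)" by (simp add: inverse_eq_divide)
  moreover have "zeta_real (real j) = (\<Sum>r. 1 / real (Suc r) ^ j)"
    unfolding zeta_real_def by (simp add: powr_realpow del: of_nat_Suc)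
  ultimately show ?thesis by (simp add: summable_LIMSEQ)
qed

text \<open>After the exchange of summation and the power sum formula, the harmonic sums and the
  terms linear in N cancel. The Bernoulli terms give partial sums of zeta values, and the rest
  converges to the two fractions.\<close>

lemma sum_tail_rem_LIMSEQ:
  assumes "k > 0"
  shows "(\<lambda>N. \<Sum>m<N. tail_rem k (Suc m)) \<longlonglongrightarrow>
           1 / (2 * real k) - 1 / (2 * real (Suc k)) + (\<Sum>j=2..k. bern_coeff k j * zeta_real (real j))"
proof -
  define Z where "Z N = (\<Sum>j=2..k. bern_coeff k j * (\<Sum>r<N. 1 / real (Suc r) ^ j))" for N
  define w where "w N = (\<Sum>j=2..k. bern_coeff k j * (real N / real N ^ j))" for N
  have "w \<longlonglongrightarrow> (\<Sum>j=2..k. bern_coeff k j * 0)"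
    unfolding w_def
  proof (intro tendsto_sum tendsto_mult tendsto_const)
    fix j assume j: "j \<in> {2..k}"
    show "(\<lambda>N. real N / real N ^ j) \<longlonglongrightarrow> 0"
    proof (rule Lim_null_comparison)
      show "\<forall>\<^sub>F N in sequentially. norm (real N / real N ^ j) \<le> 1 / real N"
        using eventually_gt_at_top[of 0]
      proof eventually_elim
        case (elim N)
        have "real N ^ 2 \<le> real N ^ j" using elim j by (intro power_increasing) auto
        hence "real N / real N ^ j \<le> real N / real N ^ 2" using elim by (intro divide_left_mono) auto
        thus ?case using elim by (simp add: power2_eq_square)
      qed
      show "(\<lambda>N. 1 / real N) \<longlonglongrightarrow> 0" by real_asymp
    qed
  qed
  hence w: "w \<longlonglongrightarrow> 0" by simp
  \<comment> \<open>The tail at N is multiplied by a power sum with leading term N/(k + 1), so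
    \<open>tail_rem\<close> must beat a factor N; its order 1/N^2 suffices.\<close>
  have e: "(\<lambda>N. real N * tail_rem k N) \<longlonglongrightarrow> 0" 
  proof (rule Lim_null_comparison)
    show "\<forall>\<^sub>F N in sequentially. norm (real N * tail_rem k N) \<le> 2 ^ k * 5 / real N"
      using eventually_gt_at_top[of 0]
    proof eventually_elim
      case (elim N)
      have "real N * \<bar>tail_rem k N\<bar> \<le> real N * (2 ^ k * (5 / real N ^ 2))"
        using abs_tail_rem_le[OF assms elim] by (intro mult_left_mono) auto
      also have "\<dots> = 2 ^ k * 5 / real N" using elim by (simp add: power2_eq_square)
      finally show ?case by (simp add: abs_mult)
    qed
    show "(\<lambda>N. 2 ^ k * 5 / real N) \<longlonglongrightarrow> 0" by real_asymp
  qed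
  have inv: "(\<lambda>N. 1 / real N) \<longlonglongrightarrow> 0" by real_asymp
  \<comment> \<open>This rewrites the partial sum with all divergent contributions cancelled, so
    that each remaining ingredient has a limit.\<close>
  define f where "f N = Z N - 1 / (2 * real (Suc k)) + real N * tail_rem k N / real (Suc k)
      + (1 / 2 + w N) * (1 / real k - 1 / real N / 2 + real N * tail_rem k N * (1 / real N))" for N
  have eq: "f N = (\<Sum>m<N. tail_rem k (Suc m))" if N: "N > 0" for N
  proof -
    define S where "S = (\<Sum>m<N. real m ^ k)"
    have "S / real N ^ Suc k = 1 / real (Suc k) - 1 / real N / 2 + w N / real N"
    proof -
      have "w N / real N = (\<Sum>j=2..k. bern_coeff k j * (1 / real N ^ j))"
        unfolding w_def sum_divide_distrib using N by simp
      thus ?thesis unfolding S_def sum_powers_over_power[OF assms N] by simp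
    qed
    hence "S = (1 / real (Suc k) - 1 / real N / 2 + w N / real N) * real N ^ Suc k"
      using N by (simp add: divide_eq_eq del: of_nat_Suc)
    also have "\<dots> = (real N / real (Suc k) - 1 / 2 + w N) * real N ^ k"
      using N by (simp add: distrib_right left_diff_distrib del: of_nat_Suc)
    \<comment> \<open>Including m = N in the power sum changes -1/2 to +1/2.\<close>
    finally have S: "S + real N ^ k = (real N / real (Suc k) + 1 / 2 + w N) * real N ^ k"
      by (simp add: distrib_right left_diff_distrib)
    have "(\<Sum>m<N. tail_rem k (Suc m)) = (\<Sum>m<N. real (Suc m) ^ k * power_tail k (Suc m)) - real N / real k + harm N / 2"
      by (simp add: tail_rem_def sum.distrib sum_subtractf harm_altdef sum_divide_distrib inverse_eq_divide mult.commute del: of_nat_Suc)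
    also have "(\<Sum>m<N. real (Suc m) ^ k * power_tail k (Suc m)) =
        (\<Sum>r<N. 1 / real (Suc k) - 1 / real (Suc r) / 2 + (\<Sum>j=2..k. bern_coeff k j * (1 / real (Suc r) ^ j)))
        + (S + real N ^ k) * power_tail k N"
      unfolding sum_power_times_tail[OF assms] S_def sum.lessThan_Suc[of _ N]
      by (simp only: sum_powers_over_power[OF assms zero_less_Suc])
    also have "(\<Sum>r<N. 1 / real (Suc k) - 1 / real (Suc r) / 2 + (\<Sum>j=2..k. bern_coeff k j * (1 / real (Suc r) ^ j)))
       = real N / real (Suc k) - harm N / 2 + Z N"
      unfolding Z_def sum.distrib sum_subtractf sum_distrib_left
      by (subst (2) sum.swap) (simp add: harm_altdef sum_divide_distrib inverse_eq_divide del: of_nat_Suc)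
    also have "(S + real N ^ k) * power_tail k N = (real N / real (Suc k) + 1 / 2 + w N) * (tail_rem k N + 1 / real k - 1 / real N / 2)"
      unfolding S tail_rem_def by (simp add: mult.assoc mult.commute[of 2])
    finally have "(\<Sum>m<N. tail_rem k (Suc m)) = real N / real (Suc k) - harm N / 2 + Z N +
        (real N / real (Suc k) + 1 / 2 + w N) * (tail_rem k N + 1 / real k - 1 / real N / 2) - real N / real k + harm N / 2" .
    moreover have "real N / real (Suc k) * (1 / real k) + real N / real (Suc k) - real N / real k = 0"
    proof -
      have "x / (1 + y) * (1 / y) + x / (1 + y) - x / y = 0" if "y > 0" for x y :: real
        using that by (simp add: divide_simps) (simp add: algebra_simps)
      from this[of "real k" "real N"] show ?thesis using assms by simp
    qed
    moreover have "real N / real (Suc k) * (1 / real N / 2) = 1 / (2 * real (Suc k))"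
      using N by simp
    moreover have "real N * tail_rem k N * (1 / real N) = tail_rem k N" using N by simp
    ultimately show ?thesis unfolding f_def by (simp only: ring_distribs) (simp add: algebra_simps)
  qed
  have "f \<longlonglongrightarrow> (\<Sum>j=2..k. bern_coeff k j * zeta_real (real j)) - 1 / (2 * real (Suc k)) + 0 / real (Suc k)
     + (1 / 2 + 0) * (1 / real k - 0 / 2 + 0 * 0)"
    unfolding f_def Z_def
    by (intro tendsto_intros e w inv zeta_real_LIMSEQ) auto
  hence "f \<longlonglongrightarrow> 1 / (2 * real k) - 1 / (2 * real (Suc k)) + (\<Sum>j=2..k. bern_coeff k j * zeta_real (real j))"
    by (simp add: algebra_simps)
  thus ?thesis
    by (rule Lim_transform_eventually) (rule eventually_mono[OF eventually_gt_at_top[of 0] eq])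
qed

lemma higher_deriv_A_fun_1:
  assumes "k > 0"
  shows "(deriv ^^ k) A_fun 1 = (-1) ^ k * fact k * (C_const - 1 / (2 * (real k + 1)) - harm (k - 1) / 2
           + (\<Sum>j=2..k. bern_coeff k j * zeta_real (real j)))"
proof -
  have "(\<lambda>N. (-1) ^ k * fact k * (C_const - harm k / 2 + (\<Sum>m<N. tail_rem k (Suc m)))) \<longlonglongrightarrow>
      (-1) ^ k * fact k * (C_const - harm k / 2 + (1 / (2 * real k) - 1 / (2 * real (Suc k))
         + (\<Sum>j=2..k. bern_coeff k j * zeta_real (real j))))"
    by (intro tendsto_intros sum_tail_rem_LIMSEQ assms)
  from LIMSEQ_unique[OF higher_deriv_A_fun_LIMSEQ_real[OF assms] this]
  have "(deriv ^^ k) A_fun 1 = (-1) ^ k * fact k * (C_const - harm k / 2 + (1 / (2 * real k) - 1 / (2 * real (Suc k))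
         + (\<Sum>j=2..k. bern_coeff k j * zeta_real (real j))))" .
  \<comment> \<open>The 1/(2k) from the limit of the tails lowers the harmonic index to k -
    1.\<close>
  also have "harm k / 2 = harm (k - 1) / 2 + 1 / (2 * real k)"
    using assms by (cases k) (auto simp: harm_Suc inverse_eq_divide add_divide_distrib mult.commute simp del: of_nat_Suc)
  finally show ?thesis by (simp add: algebra_simps)
qed

text \<open>Order 0 needs its own argument, as the tails of the harmonic series diverge. At v = 1
  the partial sums are explicit, since psi(m + 1) = H_m - gamma. The logarithms sum to ln N!, so
  Stirling's formula enters twice, which doubles C.\<close>

lemma A_fun_1: "A_fun 1 = 2 * C_const - 1 / 2"
proof -
  \<comment> \<open>The bracket is (N + 1) (H_N - gamma - ln N), split as
    \<open>psi_rem_real\<close> plus 1/(2N); its two parts tend to 0 and 1/2.\<close>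
  define L where "L N = 2 * stirling_rem (real N) - euler_mascheroni 
      - ((real N + 1) * psi_rem_real (real N) + (real N + 1) * (1 / (2 * real N)))" for N
  have D: "Digamma (real m + 1) = harm m - euler_mascheroni" for m
    using Digamma_of_nat[of m, where ?'a = real] by (simp add: add_ac)
  have eq: "(ln_Gamma (real N * 1 + 1) - real N * 1 * ln (real N * 1) + real N * 1) / 1
            - (\<Sum>m<N. Digamma (real (Suc m) * 1 + 1) - ln (real (Suc m) * 1)) = L N" if "N > 0" for N
  proof -
    have harm: "(\<Sum>m<N. harm (Suc m)) = (real N + 1) * harm N - real N" for N
    proof (induction N)
      case (Suc N)
      show ?case unfolding sum.lessThan_Suc Suc.IH
        by (simp add: harm_Suc distrib_right inverse_eq_divide add_divide_distrib del: of_nat_Suc) (simp add: field_simps)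
    qed (simp add: harm_def)
    have "(\<Sum>m<N. ln (real (Suc m))) = ln_Gamma (real N + 1)"
    proof (induction N)
      case (Suc N)
      have "ln_Gamma (real (Suc N) + 1) = ln (fact (Suc N))" for N
        using ln_Gamma_real_conv_fact[of "Suc (Suc N)"] by (simp add: add_ac)
      moreover have "ln_Gamma (real N + 1) = ln (fact N)" for N
        using ln_Gamma_real_conv_fact[of "Suc N"] by (simp add: add_ac)
      ultimately show ?case using Suc by (simp add: ln_mult add_ac del: of_nat_Suc)
    qed (use ln_Gamma_real_conv_fact[of 1] in simp)
    hence "(\<Sum>m<N. Digamma (real (Suc m) * 1 + 1) - ln (real (Suc m) * 1)) =
       (real N + 1) * harm N - real N - real N * euler_mascheroni - ln_Gamma (real N + 1)"
      by (simp add: D sum_subtractf harm del: of_nat_Suc)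
    thus ?thesis
      unfolding L_def stirling_rem_def psi_rem_real_def D by (simp add: algebra_simps)
  qed
  have "(\<lambda>N. L N) \<longlonglongrightarrow> 2 * (ln (2 * pi) / 2) - euler_mascheroni - (0 + 1 / 2)"
  proof -
    have "(\<lambda>N. (real N + 1) * psi_rem_real (real N)) \<longlonglongrightarrow> 0"
    proof (rule Lim_null_comparison)
      show "\<forall>\<^sub>F N in sequentially. norm ((real N + 1) * psi_rem_real (real N)) \<le> (real N + 1) * (1 / real N ^ 2)"
        using eventually_ge_at_top[of 1]
      proof eventually_elim
        case (elim N)
        thus ?case using abs_psi_rem_real_le[of "real N"]
          by (auto simp only: real_norm_def abs_mult intro!: mult_mono)
      qed
      show "(\<lambda>N. (real N + 1) * (1 / real N ^ 2)) \<longlonglongrightarrow> 0" by real_asymp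
    qed
    moreover have "(\<lambda>N. (real N + 1) * (1 / (2 * real N))) \<longlonglongrightarrow> 1 / 2" by real_asymp
    ultimately have "(\<lambda>N. (real N + 1) * psi_rem_real (real N) + (real N + 1) * (1 / (2 * real N))) \<longlonglongrightarrow> 0 + 1 / 2"
      by (rule tendsto_add)
    moreover have "(\<lambda>N. stirling_rem (real N)) \<longlonglongrightarrow> ln (2 * pi) / 2"
      by (rule filterlim_compose[OF stirling_rem_tendsto filterlim_real_sequentially])
    ultimately show ?thesis unfolding L_def
      by (intro tendsto_diff tendsto_mult tendsto_const)
  qed
  moreover have "(\<lambda>N. L N) \<longlonglongrightarrow> A_fun 1"
    using A_fun_LIMSEQ[OF zero_less_one] by (rule Lim_transform_eventually)
      (rule eventually_mono[OF eventually_gt_at_top[of 0] eq])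
  ultimately have "A_fun 1 = 2 * (ln (2 * pi) / 2) - euler_mascheroni - (0 + 1 / 2)"
    by (rule LIMSEQ_unique[rotated])
  thus ?thesis by (simp add: C_const_def)
qed

text \<open>Since \<open>deriv\<close> is total, smoothness is expressed by differentiability of
  every iterate. Truncated subtraction makes \<open>harm (k - 1)\<close> equal to 0 at k = 0, in
  agreement with H_{-1} = 0.\<close>

theorem theorem2:
  shows "(\<forall>k. \<forall>v>0. (deriv ^^ k) A_fun differentiable (at v))
    \<and> (\<forall>k::nat. (deriv ^^ k) A_fun 1 =
        (-1) ^ k * fact k *
          ((if k = 0 then 2 else 1) * C_const - 1 / (2 * (real k + 1)) - harm (k - 1) / 2
           + (\<Sum>j=2..k. real (k choose (j - 1)) * zeta_real (real j) * bernoulli_num j / real j)))"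
proof (intro conjI allI impI)
  fix k and v :: real assume "v > 0"
  thus "(deriv ^^ k) A_fun differentiable (at v)"
    by (intro higher_deriv_of_real_restrict(2)[OF holomorphic_A_complex open_halfplane _ A_complex_of_real]) simp_all
next
  fix k :: nat
  show "(deriv ^^ k) A_fun 1 =
        (-1) ^ k * fact k *
          ((if k = 0 then 2 else 1) * C_const - 1 / (2 * (real k + 1)) - harm (k - 1) / 2
           + (\<Sum>j=2..k. real (k choose (j - 1)) * zeta_real (real j) * bernoulli_num j / real j))"
  proof (cases "k = 0")
    case True
    thus ?thesis by (simp add: A_fun_1 harm_def)
  next
    case False
    thus ?thesis by (simp add: higher_deriv_A_fun_1 bern_coeff_def mult_ac)
  qed
qed

end
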